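(* Let $\alpha,\beta>0$ and suppose $L_n,R_n\to\infty$ with $R_n/L_n\to\gamma\in(0,\infty)$. Let $(B^*_t)_{t\ge0}$ be the bipartite multigraph process with parameters $\alpha,\beta$ on parts $\mathcal L,\mathcal R$ with $|\mathcal L|=L_n$, $|\mathcal R|=R_n$. Define $\tau_{c,n}:=(L_n+R_n)^{1+(\alpha\wedge\beta)^{-1}}$ and let $t=t_n$ be a sequence of times. Then $$\lim_{n\to\infty}\mathbb P(B^*_t\text{ is connected})=\begin{cases}0,&\text{if } t/\tau_{c,n}\to0,\\ 1,&\text{if } t/\tau_{c,n}\to\infty.\end{cases}$$ Furthermore, if $\lim_{n\to\infty} t/\tau_{c,n}=x\in(0,\infty)$, then $$\lim_{n\to\infty}\mathbb P(B^*_t\text{ is connected})=\begin{cases}\exp\left(-\left(\frac{\alpha\wedge\beta}{x}\right)^{\alpha\wedge\beta}\left[\zeta(\rho^{-1}(\alpha\wedge\beta))\right]^{-1-\alpha\wedge\beta}\right),&\text{if }\alpha\ne\beta,\\[4pt] \exp\left(-\left(\frac{\alpha}{x}\right)^{\alpha}\left((1+\gamma)^{-1-\alpha}+(1+1/\gamma)^{-1-\alpha}\right)\right),&\text{if }\alpha=\beta.\end{cases}$$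
   Context: The vertex set is $V=\mathcal L\cup\mathcal R$, a disjoint union, with $|\mathcal L|=L_n$, $|\mathcal R|=R_n$. The multigraph process $(B^*_t)$ starts from the graph $B^*_0$ on $V$ with no edges. Given $B^*_t$, one samples a pair $\{u,v\}$, $u\in\mathcal L$, $v\in\mathcal R$ (repetition of existing edges allowed), with probability $$\frac{(d_u(t)+\alpha)(d_v(t)+\beta)}{\sum_{x\in\mathcal L,\,y\in\mathcal R}(d_x(t)+\alpha)(d_y(t)+\beta)},$$ where $d_w(t)$ is the degree of $w$ in $B^*_t$ (with multiplicity), and adds the edge $\{u,v\}$ to obtain $B^*_{t+1}$. The maps $\rho,\zeta$ on $\{\mathcal L,\mathcal R\}$ are $\rho(\mathcal L)=\alpha$, $\rho(\mathcal R)=\beta$, $\zeta(\mathcal L)=1+\gamma$, $\zeta(\mathcal R)=1+1/\gamma$; when $\alpha\neq\beta$, $\rho$ is injective and $\rho^{-1}(\alpha\wedge\beta)$ is the part whose parameter is $\alpha\wedge\beta=\min(\alpha,\beta)$. *)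

theory Defs
  imports "HOL-Probability.Probability" "Graph_Theory.Digraph_Component"
begin

text \<open>
  A multigraph on the disjoint parts \<open>A\<close> (left) and \<open>B\<close> (right) is given by the multiset of its
  edges; an edge \<open>{u, v}\<close> with \<open>u \<in> A\<close> and \<open>v \<in> B\<close> is written as the pair \<open>(u, v)\<close>. Since the
  parts are disjoint, the orientation carries no information.
\<close>

type_synonym 'v edges = "('v \<times> 'v) multiset"

definition deg :: "'v edges \<Rightarrow> 'v \<Rightarrow> nat" where
  "deg M w = size {#e \<in># M. fst e = w \<or> snd e = w#}"

text \<open>
  Connectedness does not depend on multiplicities, so parallel edges are merged here. The notion of
  connectedness in \<open>Graph_Theory\<close> is that of the underlying undirected graph.
\<close>

definition graph_of :: "'v set \<Rightarrow> 'v set \<Rightarrow> 'v edges \<Rightarrow> ('v, 'v \<times> 'v) pre_digraph" where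
  "graph_of A B M = \<lparr>verts = A \<union> B, arcs = set_mset M, tail = fst, head = snd\<rparr>"

definition is_connected :: "'v set \<Rightarrow> 'v set \<Rightarrow> 'v edges \<Rightarrow> bool" where
  "is_connected A B M \<longleftrightarrow> Digraph_Component.connected (graph_of A B M)"

definition edge_prob ::
  "real \<Rightarrow> real \<Rightarrow> 'v set \<Rightarrow> 'v set \<Rightarrow> 'v edges \<Rightarrow> 'v \<times> 'v \<Rightarrow> real" where
  "edge_prob \<alpha> \<beta> A B M = (\<lambda>(u, v).
     if u \<in> A \<and> v \<in> B
     then (real (deg M u) + \<alpha>) * (real (deg M v) + \<beta>) /
          (\<Sum>(x, y)\<in>A \<times> B. (real (deg M x) + \<alpha>) * (real (deg M y) + \<beta>))
     else 0)"

text \<open>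
  The law of the added edge. It is meaningful only when \<open>edge_prob\<close> is a probability mass function;
  see \<open>pmf_edge_pmf\<close> below.
\<close>

definition edge_pmf ::
  "real \<Rightarrow> real \<Rightarrow> 'v set \<Rightarrow> 'v set \<Rightarrow> 'v edges \<Rightarrow> ('v \<times> 'v) pmf" where
  "edge_pmf \<alpha> \<beta> A B M = embed_pmf (edge_prob \<alpha> \<beta> A B M)"

text \<open>The law of the state at time \<open>t\<close> of the Markov chain.\<close>

primrec multigraph_process ::
  "real \<Rightarrow> real \<Rightarrow> 'v set \<Rightarrow> 'v set \<Rightarrow> nat \<Rightarrow> 'v edges pmf" where
  "multigraph_process \<alpha> \<beta> A B 0 = return_pmf {#}"
| "multigraph_process \<alpha> \<beta> A B (Suc t) =
     bind_pmf (multigraph_process \<alpha> \<beta> A B t)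
       (\<lambda>M. map_pmf (\<lambda>e. add_mset e M) (edge_pmf \<alpha> \<beta> A B M))"

lemma pmf_edge_pmf:
  assumes "\<alpha> > 0" "\<beta> > 0" "finite A" "finite B" "A \<noteq> {}" "B \<noteq> {}"
  shows "pmf (edge_pmf \<alpha> \<beta> A B M) e = edge_prob \<alpha> \<beta> A B M e"
proof -
  define w where "w = (\<lambda>(x, y). (real (deg M x) + \<alpha>) * (real (deg M y) + \<beta>))"
  have wpos: "w p > 0" for p
    using assms by (auto simp: w_def split: prod.splits intro!: mult_pos_pos add_nonneg_pos)
  have S: "sum w (A \<times> B) > 0"
    using assms wpos by (intro sum_pos) auto
  have eq: "edge_prob \<alpha> \<beta> A B M p = (if p \<in> A \<times> B then w p / sum w (A \<times> B) else 0)" for p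
    by (cases p) (simp add: edge_prob_def w_def)
  have nn: "edge_prob \<alpha> \<beta> A B M p \<ge> 0" for p
    unfolding eq using wpos[of p] S by (auto intro!: divide_nonneg_pos)
  have "(\<integral>\<^sup>+p. ennreal (edge_prob \<alpha> \<beta> A B M p) \<partial>count_space UNIV)
      = (\<Sum>p\<in>A \<times> B. ennreal (edge_prob \<alpha> \<beta> A B M p))"
    using assms by (intro nn_integral_count_space') (auto simp: eq)
  also have "\<dots> = ennreal (\<Sum>p\<in>A \<times> B. edge_prob \<alpha> \<beta> A B M p)"
    using nn by (intro sum_ennreal) auto
  also have "(\<Sum>p\<in>A \<times> B. edge_prob \<alpha> \<beta> A B M p) = (\<Sum>p\<in>A \<times> B. w p / sum w (A \<times> B))"
    by (intro sum.cong) (auto simp: eq)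
  also have "\<dots> = 1"
    using S by (simp flip: sum_divide_distrib)
  finally show ?thesis
    unfolding edge_pmf_def using nn by (intro pmf_embed_pmf) auto
qed

datatype part = LeftPart | RightPart

fun rho :: "real \<Rightarrow> real \<Rightarrow> part \<Rightarrow> real" where
  "rho \<alpha> \<beta> LeftPart = \<alpha>"
| "rho \<alpha> \<beta> RightPart = \<beta>"

fun zeta :: "real \<Rightarrow> part \<Rightarrow> real" where
  "zeta \<gamma> LeftPart = 1 + \<gamma>"
| "zeta \<gamma> RightPart = 1 + 1 / \<gamma>"

lemma inj_rho: "\<alpha> \<noteq> \<beta> \<Longrightarrow> inj (rho \<alpha> \<beta>)"
  by (rule injI) (metis part.exhaust rho.simps)

end

theory Submission
  imports Defs "HOL-Real_Asymp.Real_Asymp"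
begin

text \<open>
  Since the weight of an edge is a product, the left and the right endpoints form two independent
  Polya urns. For a set \<open>S\<close> in one part, the word that records which draws hit \<open>S\<close> has an explicit
  probability (a quotient of rising factorials), depending only on the number of hits. The
  probability that no vertex of a part is isolated is then an alternating sum by inclusion and
  exclusion, and its limit follows from Tannery's theorem. If there is no isolated vertex and the
  graph is disconnected, then some cut \<open>(S, T)\<close> has equal hit words on the left and on the right;
  with \<open>k\<close> hits, this costs a factor \<open>1 / (t choose k)\<close>, and a union bound over all cuts shows that
  the probability is \<open>O(N / t)\<close> with \<open>N\<close> the number of vertices. Connectedness is monotone in time,
  so the two extreme regimes follow from the critical window.
\<close>

section \<open>Quotients of rising factorials\<close>

text \<open>A vertex in a part of size \<open>n\<close> with parameter \<open>a\<close> is missed by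
  \<open>t\<close> draws with probability of order \<open>(a * n / t) powr a\<close>. The expected
  number \<open>n * (a * n / t) powr a\<close> of isolated vertices is thus of constant order when
  \<open>t\<close> is of order \<open>n powr (1 + 1 / a)\<close>, so the smaller parameter decides
  the threshold. The obstacle is the exponential number of cuts. Given \<open>k\<close> hits, all
  \<open>t choose k\<close> words are equally likely, so two independent words with \<open>k\<close>
  hits each agree with probability \<open>1 / (t choose k)\<close>, which is at most
  \<open>(k / t) ^ k\<close>. This must beat the number of cuts with \<open>k\<close> hits. Without
  isolated vertices, both \<open>S\<close> and \<open>T\<close> have at most \<open>k\<close>
  elements; in the critical window the sets of size \<open>s\<close>, weighted by the probability
  that they are hit so rarely, then contribute at most a constant to the power
  \<open>k\<close>.\<close>

lemma prod_ratio_le_powr: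
  fixes y c :: real
  assumes "y > 0" "0 \<le> c" "c \<le> y"
  shows "(\<Prod>j<t. (y - c + real j) / (y + real j)) \<le> (y / (y + real t)) powr c"
proof (induction t)
  case 0
  then show ?case using assms by simp
next
  case (Suc t)
  define z where "z = y + real t"
  have z: "z > 0" "c \<le> z" using assms by (auto simp: z_def)
  \<comment> \<open>The new factor is at most \<open>exp (- (c / z))\<close>, hence at most
    \<open>(z / (z + 1)) powr c\<close>; these powers telescope.\<close>
  have "(z - c) / z = 1 + - (c / z)" using z by (simp add: field_simps)
  also have "\<dots> \<le> exp (- (c / z))" by (rule exp_ge_add_one_self)
  also have "\<dots> \<le> (z / (z + 1)) powr c"
  proof -
    have "ln ((z + 1) / z) \<le> (z + 1) / z - 1" using z by (intro ln_le_minus_one) auto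
    also have "\<dots> = 1 / z" using z by (simp add: field_simps)
    finally have "c * ln ((z + 1) / z) \<le> c * (1 / z)" using assms by (intro mult_left_mono) auto
    then show ?thesis using z by (simp add: powr_def ln_div algebra_simps)
  qed
  finally have f: "(z - c) / z \<le> (z / (z + 1)) powr c" .
  have "(\<Prod>j<Suc t. (y - c + real j) / (y + real j))
      = (\<Prod>j<t. (y - c + real j) / (y + real j)) * ((z - c) / z)"
    by (simp add: z_def algebra_simps)
  also have "\<dots> \<le> (y / z) powr c * (z / (z + 1)) powr c"
    using Suc f z assms by (intro mult_mono) (auto simp: z_def intro!: divide_nonneg_pos)
  also have "\<dots> = (y / z * (z / (z + 1))) powr c"
    by (rule powr_mult[symmetric])
  also have "y / z * (z / (z + 1)) = y / (y + real (Suc t))"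
    using z by (simp add: z_def add_ac)
  finally show ?case .
qed

text \<open>With \<open>z = y - c + j\<close>, the factor \<open>z / (z + c)\<close> is at least
  \<open>exp (- (c / z))\<close>, hence at least \<open>((z - 1) / z) powr c\<close>. The powers
  telescope again, now with the base shifted by one, whence \<open>y - c - 1\<close> and the
  condition \<open>y - c > 1\<close>.\<close>

lemma prod_ratio_ge_powr:
  fixes y c :: real
  assumes "0 \<le> c" "y - c > 1"
  shows "(\<Prod>j<t. (y - c + real j) / (y + real j)) \<ge> ((y - c - 1) / (y - c - 1 + real t)) powr c"
proof (induction t)
  case 0
  then show ?case using assms by simp
next
  case (Suc t)
  define z where "z = y - c + real t"
  have z: "z > 1" using assms by (auto simp: z_def)
  have "ln (1 - 1 / z) \<le> - (1 / z)"
    using z by (intro order.trans[OF ln_le_minus_one]) auto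
  then have "c * ln ((z - 1) / z) \<le> - (c / z)"
    using assms mult_left_mono[of "ln (1 - 1 / z)" "- (1 / z)" c] z by (simp add: diff_divide_distrib)
  then have "((z - 1) / z) powr c \<le> exp (- (c / z))"
    using z by (simp add: powr_def)
  also have "\<dots> \<le> z / (z + c)"
  proof -
    have "1 + c / z \<le> exp (c / z)" by (rule exp_ge_add_one_self)
    then have "inverse (exp (c / z)) \<le> inverse (1 + c / z)"
      using z assms by (intro le_imp_inverse_le) (auto intro: add_pos_nonneg)
    then show ?thesis using z by (simp add: exp_minus field_simps)
  qed
  finally have f: "((z - 1) / z) powr c \<le> z / (z + c)" .
  have "((y - c - 1) / (y - c - 1 + real (Suc t))) powr c
     = ((y - c - 1) / (z - 1) * ((z - 1) / z)) powr c"
    using z by (simp add: z_def add_ac)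
  also have "\<dots> = ((y - c - 1) / (z - 1)) powr c * ((z - 1) / z) powr c"
    by (rule powr_mult)
  also have "\<dots> \<le> (\<Prod>j<t. (y - c + real j) / (y + real j)) * (z / (z + c))"
    using Suc f z assms
    by (intro mult_mono) (auto simp: z_def algebra_simps intro!: prod_nonneg divide_nonneg_nonneg)
  also have "\<dots> = (\<Prod>j<Suc t. (y - c + real j) / (y + real j))"
    by (simp add: z_def algebra_simps)
  finally show ?case .
qed

lemma pochhammer_mono_real:
  fixes a b :: real
  assumes "0 \<le> a" "a \<le> b"
  shows "pochhammer a n \<le> pochhammer b n"
  using assms unfolding pochhammer_prod by (intro prod_mono) auto

lemma pochhammer_ratio_eq_prod:
  fixes y c :: real
  shows "pochhammer (y - c) t / pochhammer y t = (\<Prod>j<t. (y - c + real j) / (y + real j))"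
  unfolding pochhammer_prod by (simp add: prod_dividef lessThan_atLeast0)

lemma binomial_eq_pochhammer:
  "real ((k + m) choose k) = pochhammer (real m + 1) k / fact k"
  by (simp add: binomial_gbinomial gbinomial_pochhammer' algebra_simps)

text \<open>
  With \<open>c = a |S|\<close> and \<open>y = a |A|\<close> the left-hand side is the probability that exactly \<open>k\<close> of
  \<open>k + m\<close> urn draws hit \<open>S\<close>. The assumption on \<open>c\<close> holds because \<open>S\<close> without isolated vertices
  is hit at least \<open>|S|\<close> times.
\<close>

lemma beta_binomial_bound:
  fixes y c :: real
  assumes "1 \<le> y" "0 \<le> c" "c \<le> y" "c \<le> real (e * k)"
  shows "real ((k + m) choose k) * (pochhammer c k * pochhammer (y - c) m / pochhammer y (k + m))
    \<le> (y / (y + real m)) powr c * (2 ^ (e + 1)) ^ k"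
proof -
  have pos: "pochhammer y m > 0" "pochhammer (y + real m) k > 0"
    using assms by (auto intro!: pochhammer_pos)
  have nn: "pochhammer c k \<ge> 0" using assms by (auto simp: pochhammer_prod intro!: prod_nonneg)
  have "pochhammer (y - c) m / pochhammer y m \<le> (y / (y + real m)) powr c"
    unfolding pochhammer_ratio_eq_prod using assms by (intro prod_ratio_le_powr) auto
  \<comment> \<open>The misses have produced the power of \<open>y / (y + m)\<close>; the hits cost
    only an exponential factor. As \<open>y\<close> is at least 1, the denominator absorbs
    \<open>pochhammer (m + 1) k\<close> from the binomial coefficient. As \<open>c\<close> is at
    most \<open>e * k\<close>, what remains is bounded by another binomial coefficient.\<close>
  moreover have "real ((k + m) choose k) * pochhammer c k / pochhammer (y + real m) k \<le> (2 ^ (e + 1)) ^ k"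
  proof -
    have "real ((k + m) choose k) * pochhammer c k / pochhammer (y + real m) k
        = pochhammer c k / fact k * (pochhammer (real m + 1) k / pochhammer (y + real m) k)"
      unfolding binomial_eq_pochhammer by simp
    also have "\<dots> \<le> pochhammer c k / fact k * 1"
      using pos assms nn by (intro mult_left_mono) (auto intro!: pochhammer_mono_real)
    also have "\<dots> \<le> pochhammer (real (e * k) + 1) k / fact k"
      using assms by (auto intro!: divide_right_mono pochhammer_mono_real)
    also have "\<dots> = real ((k + e * k) choose k)"
      by (rule binomial_eq_pochhammer[symmetric])
    also have "\<dots> \<le> real (2 ^ (k + e * k))"
      by (intro of_nat_mono binomial_le_pow2)
    also have "\<dots> = (2 ^ (e + 1)) ^ k"
      by (simp add: power_mult [symmetric] power_add algebra_simps)
    finally show ?thesis .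
  qed
  ultimately have "(pochhammer (y - c) m / pochhammer y m) *
      (real ((k + m) choose k) * pochhammer c k / pochhammer (y + real m) k)
      \<le> (y / (y + real m)) powr c * (2 ^ (e + 1)) ^ k"
    using pos nn by (intro mult_mono) (auto intro!: divide_nonneg_pos)
  moreover have "pochhammer y (k + m) = pochhammer y m * pochhammer (y + real m) k"
    using pochhammer_product'[of y m k] by (simp add: add.commute)
  ultimately show ?thesis by (simp add: mult_ac)
qed

section \<open>Poisson limit of the inclusion-exclusion sum\<close>

lemma binomial_over_power_tendsto:
  assumes "filterlim L at_top F"
  shows "((\<lambda>n. real (L n choose k) / real (L n) ^ k) \<longlongrightarrow> 1 / fact k) F"
proof -
  have Linf: "filterlim (\<lambda>n. real (L n)) at_top F"
    using filterlim_compose[OF filterlim_real_sequentially assms] .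
  have "((\<lambda>n. \<Prod>i<k. (1 - real i / real (L n)) / real (k - i)) \<longlongrightarrow> (\<Prod>i<k. (1 - 0) / real (k - i))) F"
    by (intro tendsto_prod tendsto_divide tendsto_diff tendsto_const
          tendsto_divide_0[OF tendsto_const filterlim_at_top_imp_at_infinity[OF Linf]]) auto
  also have "(\<Prod>i<k. (1 - 0) / real (k - i)) = 1 / fact k"
  proof -
    have "(\<Prod>i<k. real (k - i)) = fact k"
      by (induction k) (simp_all add: prod.lessThan_Suc_shift del: prod.lessThan_Suc)
    then show ?thesis by (simp add: prod_dividef)
  qed
  finally have lim: "((\<lambda>n. \<Prod>i<k. (1 - real i / real (L n)) / real (k - i)) \<longlongrightarrow> 1 / fact k) F" .
  have "eventually (\<lambda>n. L n \<ge> Suc k) F"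
    using assms by (auto simp: filterlim_at_top)
  then have ev: "eventually (\<lambda>n. (\<Prod>i<k. (1 - real i / real (L n)) / real (k - i))
        = real (L n choose k) / real (L n) ^ k) F"
  proof eventually_elim
    case (elim n)
    have "real (L n choose k) / real (L n) ^ k
        = (\<Prod>i<k. real (L n - i) / real (k - i)) / (\<Prod>i<k. real (L n))"
      using elim by (simp add: binomial_altdef_of_nat lessThan_atLeast0)
    also have "\<dots> = (\<Prod>i<k. real (L n - i) / real (k - i) / real (L n))"
      by (rule prod_dividef[symmetric])
    also have "\<dots> = (\<Prod>i<k. (1 - real i / real (L n)) / real (k - i))"
      using elim by (intro prod.cong) (auto simp: of_nat_diff field_simps)
    finally show ?case by simp
  qed
  show ?thesis by (rule Lim_transform_eventually[OF lim ev])
qed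

text \<open>Up to sign, the \<open>k\<close>-th term is the binomial moment of order
  \<open>k\<close> of the number of isolated vertices. It tends to
  \<open>\<mu> ^ k / fact k\<close>, the corresponding moment of a Poisson variable of mean \<mu>,
  and \<open>exp (- \<mu>)\<close> is the Poisson probability of zero.\<close>

lemma alternating_avoidance_tendsto:
  fixes \<alpha> \<mu> :: real and L T :: "nat \<Rightarrow> nat"
  assumes a: "\<alpha> > 0" and L: "filterlim L at_top sequentially"
    and TL: "filterlim (\<lambda>n. real (T n) / real (L n)) at_top sequentially"
    and lim: "(\<lambda>n. real (L n) * (\<alpha> * real (L n) / real (T n)) powr \<alpha>) \<longlonglongrightarrow> \<mu>"
  shows "(\<lambda>n. \<Sum>k\<le>L n. (-1) ^ k * (real (L n choose k) *
      (\<Prod>j<T n. (\<alpha> * real (L n) - \<alpha> * real k + real j) / (\<alpha> * real (L n) + real j)))) \<longlonglongrightarrow> exp (- \<mu>)"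
proof -
  define q where "q = (\<lambda>k n. \<Prod>j<T n. (\<alpha> * real (L n) - \<alpha> * real k + real j) / (\<alpha> * real (L n) + real j))"
  define f where "f = (\<lambda>k n. (-1) ^ k * (real (L n choose k) * q k n))"
  \<comment> \<open>For each \<open>k\<close>, the powers \<open>lo k n ^ k\<close> and
    \<open>up n ^ k\<close> eventually enclose \<open>L n ^ k * q k n\<close>, and both bases tend
    to \<mu>.\<close>
  define up where "up = (\<lambda>n. real (L n) * (\<alpha> * real (L n) / (\<alpha> * real (L n) + real (T n))) powr \<alpha>)"
  define lo where "lo = (\<lambda>k n. real (L n) * ((\<alpha> * real (L n) - \<alpha> * real k - 1) /
      (\<alpha> * real (L n) - \<alpha> * real k - 1 + real (T n))) powr \<alpha>)"
  have Linf: "filterlim (\<lambda>n. real (L n)) at_top sequentially"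
    using filterlim_compose[OF filterlim_real_sequentially L] .
  have evL: "eventually (\<lambda>n. real (L n) > K) sequentially" for K
    using Linf by (auto simp: filterlim_at_top_dense)
  have evT: "eventually (\<lambda>n. real (T n) / real (L n) > 0) sequentially"
    using TL by (auto simp: filterlim_at_top_dense)
  have inv: "(\<lambda>n. c / real (L n)) \<longlonglongrightarrow> 0" for c
    by (intro tendsto_divide_0[OF tendsto_const filterlim_at_top_imp_at_infinity[OF Linf]])
  have LT: "(\<lambda>n. real (L n) / real (T n)) \<longlonglongrightarrow> 0"
  proof -
    have "(\<lambda>n. 1 / (real (T n) / real (L n))) \<longlonglongrightarrow> 0"
      by (intro tendsto_divide_0[OF tendsto_const filterlim_at_top_imp_at_infinity[OF TL]])
    then show ?thesis by simp
  qed
  have shifted: "(\<lambda>n. real (L n) * ((\<alpha> * real (L n) - d) / (\<alpha> * real (L n) - d + real (T n))) powr \<alpha>) \<longlonglongrightarrow> \<mu>"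
    for d
  proof -
    \<comment> \<open>\<open>r\<close> is the correction from \<open>\<alpha> * L n / T n\<close> to
      the shifted quotient. It tends to 1 because \<open>d\<close> is negligible against
      \<open>L n\<close>, and \<open>L n\<close> against \<open>T n\<close>.\<close>
    define r where "r = (\<lambda>n. (1 - d / \<alpha> / real (L n)) / (1 + \<alpha> * (real (L n) / real (T n)) * (1 - d / \<alpha> / real (L n))))"
    have "r \<longlonglongrightarrow> (1 - 0) / (1 + \<alpha> * 0 * (1 - 0))"
      unfolding r_def by (intro tendsto_intros LT inv) auto
    then have "(\<lambda>n. r n powr \<alpha>) \<longlonglongrightarrow> 1 powr \<alpha>"
      by (intro tendsto_intros) auto
    from tendsto_mult[OF lim this]
    have "(\<lambda>n. real (L n) * (\<alpha> * real (L n) / real (T n)) powr \<alpha> * r n powr \<alpha>) \<longlonglongrightarrow> \<mu>" by simp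
    moreover have "eventually (\<lambda>n. real (L n) * (\<alpha> * real (L n) / real (T n)) powr \<alpha> * r n powr \<alpha>
       = real (L n) * ((\<alpha> * real (L n) - d) / (\<alpha> * real (L n) - d + real (T n))) powr \<alpha>) sequentially"
      using evL[of "max 0 (d / \<alpha>)"] evT
    proof eventually_elim
      case (elim n)
      have pos: "real (L n) > 0" "real (T n) > 0" "\<alpha> * real (L n) - d > 0"
        using elim a by (auto simp: field_simps zero_less_divide_iff)
      have s: "1 - d / \<alpha> / real (L n) = (\<alpha> * real (L n) - d) / (\<alpha> * real (L n))"
        using pos a by (simp add: field_simps)
      have "r n = (\<alpha> * real (L n) - d) / (\<alpha> * real (L n)) /
          (1 + (\<alpha> * real (L n) - d) / real (T n))"
        unfolding r_def s using pos a by simp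
      also have "\<dots> = (\<alpha> * real (L n) - d) / (\<alpha> * real (L n)) * (real (T n) / (\<alpha> * real (L n) - d + real (T n)))"
        using pos a by (simp add: field_simps)
      finally have r: "\<alpha> * real (L n) / real (T n) * r n = (\<alpha> * real (L n) - d) / (\<alpha> * real (L n) - d + real (T n))"
        using pos a by simp
      moreover have "r n > 0"
        unfolding r_def s using pos a by (intro divide_pos_pos add_pos_nonneg) auto
      ultimately show ?case using pos a
        by (simp add: powr_mult[symmetric] mult.assoc)
    qed
    ultimately show ?thesis by (rule Lim_transform_eventually)
  qed
  have up: "up \<longlonglongrightarrow> \<mu>"
    using shifted[of 0] by (simp add: up_def)
  have lo: "lo k \<longlonglongrightarrow> \<mu>" for k
    using shifted[of "\<alpha> * real k + 1"] by (simp add: lo_def algebra_simps)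
  have powk: "l ^ k * x powr (\<alpha> * real k) = (l * x powr \<alpha>) ^ k" if "x > 0" for l x :: real and k
    using that by (simp add: power_mult_distrib powr_powr[symmetric] powr_realpow)
  have q_le: "real (L n) ^ k * q k n \<le> up n ^ k" if "k \<le> L n" "L n > 0" for k n
  proof -
    have "q k n \<le> (\<alpha> * real (L n) / (\<alpha> * real (L n) + real (T n))) powr (\<alpha> * real k)"
      unfolding q_def using that a by (intro prod_ratio_le_powr) auto
    then have "real (L n) ^ k * q k n
        \<le> real (L n) ^ k * (\<alpha> * real (L n) / (\<alpha> * real (L n) + real (T n))) powr (\<alpha> * real k)"
      by (intro mult_left_mono) auto
    also have "\<dots> = up n ^ k"
      unfolding up_def using that a by (intro powk divide_pos_pos add_pos_nonneg) auto
    finally show ?thesis .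
  qed
  have q_nonneg: "q k n \<ge> 0" if "k \<le> L n" for k n
    unfolding q_def using that a by (intro prod_nonneg) auto
  have q_lim: "(\<lambda>n. real (L n) ^ k * q k n) \<longlonglongrightarrow> \<mu> ^ k" for k
  proof (rule tendsto_sandwich)
    show "eventually (\<lambda>n. lo k n ^ k \<le> real (L n) ^ k * q k n) sequentially"
      using evL[of "real k + 1 / \<alpha>"]
    proof eventually_elim
      case (elim n)
      have gt: "\<alpha> * real (L n) - \<alpha> * real k > 1"
        using elim a by (simp add: field_simps)
      have "((\<alpha> * real (L n) - \<alpha> * real k - 1) /
          (\<alpha> * real (L n) - \<alpha> * real k - 1 + real (T n))) powr (\<alpha> * real k) \<le> q k n"
        unfolding q_def using gt a by (intro prod_ratio_ge_powr) auto
      then have "real (L n) ^ k * ((\<alpha> * real (L n) - \<alpha> * real k - 1) /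
          (\<alpha> * real (L n) - \<alpha> * real k - 1 + real (T n))) powr (\<alpha> * real k) \<le> real (L n) ^ k * q k n"
        by (intro mult_left_mono) auto
      moreover have "real (L n) ^ k * ((\<alpha> * real (L n) - \<alpha> * real k - 1) /
          (\<alpha> * real (L n) - \<alpha> * real k - 1 + real (T n))) powr (\<alpha> * real k) = lo k n ^ k"
        unfolding lo_def using gt by (intro powk divide_pos_pos add_pos_nonneg) auto
      ultimately show ?case by simp
    qed
    show "eventually (\<lambda>n. real (L n) ^ k * q k n \<le> up n ^ k) sequentially"
      using evL[of "real k"] by eventually_elim (auto intro!: q_le)
    show "(\<lambda>n. lo k n ^ k) \<longlonglongrightarrow> \<mu> ^ k" by (intro tendsto_power lo)
    show "(\<lambda>n. up n ^ k) \<longlonglongrightarrow> \<mu> ^ k" by (intro tendsto_power up)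
  qed
  have f_lim: "f k \<longlonglongrightarrow> (- \<mu>) ^ k / fact k" for k
  proof -
    have "(\<lambda>n. (-1) ^ k * ((real (L n choose k) / real (L n) ^ k) * (real (L n) ^ k * q k n)))
        \<longlonglongrightarrow> (-1) ^ k * (1 / fact k * \<mu> ^ k)"
      by (intro tendsto_intros binomial_over_power_tendsto L q_lim)
    moreover have "eventually (\<lambda>n. (-1) ^ k * ((real (L n choose k) / real (L n) ^ k) * (real (L n) ^ k * q k n)) = f k n) sequentially"
      using evL[of 0] by eventually_elim (auto simp: f_def)
    ultimately have "f k \<longlonglongrightarrow> (-1) ^ k * (1 / fact k * \<mu> ^ k)"
      by (rule Lim_transform_eventually)
    then show ?thesis by (simp add: power_minus[of \<mu>])
  qed
  \<comment> \<open>Any constant above the limit of \<open>up\<close> dominates for all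
    \<open>k\<close> at once. The absolute value makes \<open>K\<close> positive without a separate
    proof that \<mu> is nonnegative.\<close>
  define K where "K = \<bar>\<mu>\<bar> + 1"
  have "eventually (\<lambda>n. up n < K) sequentially"
    using up by (rule order_tendstoD) (simp add: K_def)
  then have bound: "eventually (\<lambda>n. \<forall>k. norm (f k n) \<le> K ^ k / fact k) sequentially"
    using evL[of 0]
  proof eventually_elim
    case (elim n)
    have up0: "up n \<ge> 0" by (simp add: up_def)
    show ?case
    proof
      fix k
      show "norm (f k n) \<le> K ^ k / fact k"
      proof (cases "k \<le> L n")
        case False
        then show ?thesis by (simp add: f_def binomial_eq_0 K_def)
      next
        case True
        have "norm (f k n) = real (L n choose k) * q k n"
          using q_nonneg[OF True] by (simp add: f_def abs_mult)
        also have "\<dots> \<le> (real (L n) ^ k / fact k) * q k n"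
        proof (intro mult_right_mono q_nonneg True)
          have "real ((L n choose k) * fact k) \<le> real (L n ^ k)"
            using True by (intro of_nat_mono binomial_fact_pow)
          then show "real (L n choose k) \<le> real (L n) ^ k / fact k"
            by (simp add: field_simps)
        qed
        also have "\<dots> = (real (L n) ^ k * q k n) / fact k" by simp
        also have "\<dots> \<le> up n ^ k / fact k"
          using q_le[OF True] elim by (intro divide_right_mono) auto
        also have "\<dots> \<le> K ^ k / fact k"
          using elim up0 by (intro divide_right_mono power_mono) auto
        finally show ?thesis .
      qed
    qed
  qed
  have summable: "summable (\<lambda>k. K ^ k / fact k)"
    using summable_exp[of K] by (simp add: field_simps)
  \<comment> \<open>Binomial coefficients vanish beyond \<open>L n\<close>, so the finite sums are
    series over all \<open>k\<close>, to which dominated convergence applies.\<close>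
  have "(\<lambda>n. \<Sum>k. f k n) \<longlonglongrightarrow> (\<Sum>k. (- \<mu>) ^ k / fact k)"
  proof -
    have "eventually (\<lambda>(k, n). norm (f k n) \<le> K ^ k / fact k) (sequentially \<times>\<^sub>F sequentially)"
      unfolding eventually_prod_filter
      using bound by (intro exI[of _ "\<lambda>_. True"] exI[of _ "\<lambda>n. \<forall>k. norm (f k n) \<le> K ^ k / fact k"]) auto
    from tannerys_theorem[OF f_lim this summable] show ?thesis by simp
  qed
  also have "(\<Sum>k. (- \<mu>) ^ k / fact k) = exp (- \<mu>)"
    by (simp add: exp_def divide_inverse mult.commute)
  also have "(\<lambda>n. \<Sum>k. f k n) = (\<lambda>n. \<Sum>k\<le>L n. f k n)"
    by (intro ext suminf_finite) (auto simp: f_def binomial_eq_0)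
  finally show ?thesis by (simp add: f_def q_def)
qed

section \<open>Polya urns\<close>

lemma prob_bind_pmf:
  "measure_pmf.prob (bind_pmf M f) X = measure_pmf.expectation M (\<lambda>x. measure_pmf.prob (f x) X)"
proof -
  have "ennreal (measure_pmf.prob (bind_pmf M f) X) = (\<integral>\<^sup>+x. ennreal (measure_pmf.prob (f x) X) \<partial>M)"
    by (simp flip: measure_pmf.emeasure_eq_measure)
  also have "\<dots> = ennreal (measure_pmf.expectation M (\<lambda>x. measure_pmf.prob (f x) X))"
    by (intro nn_integral_eq_integral measure_pmf.integrable_const_bound[where B = 1]) auto
  finally show ?thesis by (simp add: integral_nonneg_AE)
qed

text \<open>The history is kept as a list and not as a vector of counts, because the cut argument
  compares the two urns draw by draw.\<close>

definition polya_pick :: "real \<Rightarrow> 'v set \<Rightarrow> 'v list \<Rightarrow> 'v pmf" where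
  "polya_pick a A xs = embed_pmf (\<lambda>x. if x \<in> A then (real (count_list xs x) + a) /
     (\<Sum>y\<in>A. real (count_list xs y) + a) else 0)"

text \<open>The head of the list is the most recent draw.\<close>

primrec polya_urn :: "real \<Rightarrow> 'v set \<Rightarrow> nat \<Rightarrow> 'v list pmf" where
  "polya_urn a A 0 = return_pmf []"
| "polya_urn a A (Suc t) =
     bind_pmf (polya_urn a A t) (\<lambda>xs. map_pmf (\<lambda>x. x # xs) (polya_pick a A xs))"

lemma pmf_polya_pick:
  assumes "a > 0" "finite A" "A \<noteq> {}"
  shows "pmf (polya_pick a A xs) x =
    (if x \<in> A then (real (count_list xs x) + a) / (\<Sum>y\<in>A. real (count_list xs y) + a) else 0)"
proof -
  define w where "w = (\<lambda>x. real (count_list xs x) + a)"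
  define p where "p = (\<lambda>x. if x \<in> A then w x / sum w A else 0)"
  have wpos: "w x > 0" for x using assms by (simp add: w_def add_nonneg_pos)
  have S: "sum w A > 0" using assms wpos by (intro sum_pos) auto
  have nn: "p x \<ge> 0" for x using wpos[of x] S by (auto simp: p_def)
  have "(\<integral>\<^sup>+x. ennreal (p x) \<partial>count_space UNIV) = (\<Sum>x\<in>A. ennreal (p x))"
    using assms by (intro nn_integral_count_space') (auto simp: p_def)
  also have "\<dots> = ennreal (\<Sum>x\<in>A. p x)"
    using nn by (intro sum_ennreal) auto
  also have "(\<Sum>x\<in>A. p x) = 1"
    using S by (simp add: p_def flip: sum_divide_distrib)
  finally have "pmf (embed_pmf p) x = p x"
    using nn by (intro pmf_embed_pmf) auto
  then show ?thesis unfolding polya_pick_def p_def w_def .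
qed

lemma set_polya_pick:
  assumes "a > 0" "finite A" "A \<noteq> {}"
  shows "set_pmf (polya_pick a A xs) \<subseteq> A"
  using pmf_polya_pick[OF assms, of xs] by (auto simp: set_pmf_iff split: if_splits)

lemma set_polya_urn:
  assumes "a > 0" "finite A" "A \<noteq> {}"
  shows "set_pmf (polya_urn a A t) \<subseteq> {xs. set xs \<subseteq> A \<and> length xs = t}"
  using set_polya_pick[OF assms] by (induction t) fastforce+

lemma sum_count_list_eq_filter:
  assumes "finite T"
  shows "(\<Sum>x\<in>T. count_list xs x) = length (filter (\<lambda>x. x \<in> T) xs)"
proof (induction xs)
  case (Cons a xs)
  have "(\<Sum>x\<in>T. count_list (a # xs) x) = (\<Sum>x\<in>T. count_list xs x + (if a = x then 1 else 0))"
    by (intro sum.cong) auto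
  also have "\<dots> = length (filter (\<lambda>x. x \<in> T) (a # xs))"
    using assms Cons by (simp add: sum.distrib)
  finally show ?case .
qed simp

lemma prob_polya_pick:
  assumes "a > 0" "finite A" "A \<noteq> {}" "T \<subseteq> A" "set xs \<subseteq> A"
  shows "measure_pmf.prob (polya_pick a A xs) T =
    (a * real (card T) + real (length (filter (\<lambda>x. x \<in> T) xs))) / (a * real (card A) + real (length xs))"
proof -
  have fT: "finite T" using assms finite_subset by blast
  have sum_w: "(\<Sum>x\<in>U. real (count_list xs x) + a) = a * real (card U) + real (length (filter (\<lambda>x. x \<in> U) xs))"
    if "finite U" for U
    using sum_count_list_eq_filter[OF that, of xs] by (simp add: sum.distrib flip: of_nat_sum)
  have "filter (\<lambda>x. x \<in> A) xs = xs" using assms by (auto simp: filter_id_conv)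
  then have den: "(\<Sum>y\<in>A. real (count_list xs y) + a) = a * real (card A) + real (length xs)"
    using sum_w[of A] assms by simp
  have "measure_pmf.prob (polya_pick a A xs) T = (\<Sum>x\<in>T. pmf (polya_pick a A xs) x)"
    using fT by (rule measure_measure_pmf_finite)
  also have "\<dots> = (\<Sum>x\<in>T. (real (count_list xs x) + a) / (\<Sum>y\<in>A. real (count_list xs y) + a))"
    using assms by (intro sum.cong) (auto simp: pmf_polya_pick)
  also have "\<dots> = (a * real (card T) + real (length (filter (\<lambda>x. x \<in> T) xs))) / (a * real (card A) + real (length xs))"
    unfolding den using sum_w[OF fT] by (simp flip: sum_divide_distrib)
  finally show ?thesis .
qed

text \<open>Only the total weight of \<open>S\<close> matters, so the urn collapses to two colours.
  Whatever the order of the draws, successive hits contribute the factors \<open>a * card S\<close>,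
  \<open>a * card S + 1\<close> and so on, misses likewise with the complement, and the denominators
  run through the total weights. This is the exchangeability of the urn.\<close>

lemma prob_polya_urn_pattern:
  assumes "a > 0" "finite A" "A \<noteq> {}" "S \<subseteq> A"
  shows "measure_pmf.prob (polya_urn a A (length w)) {xs. map (\<lambda>x. x \<in> S) xs = w} =
    pochhammer (a * real (card S)) (count_list w True) *
    pochhammer (a * real (card A) - a * real (card S)) (count_list w False) /
    pochhammer (a * real (card A)) (length w)"
proof (induction w)
  case Nil
  then show ?case by simp
next
  case (Cons b w)
  have fS: "finite S" using assms finite_subset by blast
  define T where "T = (if b then S else A - S)"
  have T: "T \<subseteq> A" using assms by (auto simp: T_def)
  have cT: "a * real (card T) = (if b then a * real (card S) else a * real (card A) - a * real (card S))"
    using assms fS by (simp add: T_def card_Diff_subset of_nat_diff card_mono right_diff_distrib)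
  define c where "c = (a * real (card T) + real (count_list w b)) / (a * real (card A) + real (length w))"
  have "measure_pmf.prob (polya_urn a A (length (b # w))) {xs. map (\<lambda>x. x \<in> S) xs = b # w}
    = measure_pmf.expectation (polya_urn a A (length w))
       (\<lambda>xs. measure_pmf.prob (polya_pick a A xs) ((\<lambda>x. x # xs) -` {xs. map (\<lambda>x. x \<in> S) xs = b # w}))"
    by (simp add: prob_bind_pmf)
  also have "\<dots> = measure_pmf.expectation (polya_urn a A (length w))
       (\<lambda>xs. c * indicator {xs. map (\<lambda>x. x \<in> S) xs = w} xs)"
  proof (intro integral_cong_AE AE_pmfI)
    fix xs assume "xs \<in> set_pmf (polya_urn a A (length w))"
    then have xs: "set xs \<subseteq> A" "length xs = length w"
      using set_polya_urn[OF assms(1-3), of "length w"] by auto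
    show "measure_pmf.prob (polya_pick a A xs) ((\<lambda>x. x # xs) -` {xs. map (\<lambda>x. x \<in> S) xs = b # w})
      = c * indicator {xs. map (\<lambda>x. x \<in> S) xs = w} xs"
    proof (cases "map (\<lambda>x. x \<in> S) xs = w")
      case False
      then have "(\<lambda>x. x # xs) -` {xs. map (\<lambda>x. x \<in> S) xs = b # w} = {}" by auto
      then show ?thesis using False by simp
    next
      case True
      have "measure_pmf.prob (polya_pick a A xs) ((\<lambda>x. x # xs) -` {xs. map (\<lambda>x. x \<in> S) xs = b # w})
        = measure_pmf.prob (polya_pick a A xs) T"
        using True set_polya_pick[OF assms(1-3), of xs] assms(4)
        by (intro measure_pmf.finite_measure_eq_AE AE_pmfI) (auto simp: T_def)
      also have "length (filter (\<lambda>x. x \<in> T) xs) = count_list w b"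
      proof -
        have "count_list w b = length (filter (\<lambda>x. (x \<in> S) = b) xs)"
          unfolding True[symmetric] by (induction xs) auto
        also have "filter (\<lambda>x. (x \<in> S) = b) xs = filter (\<lambda>x. x \<in> T) xs"
          using xs assms by (intro filter_cong) (auto simp: T_def)
        finally show ?thesis by simp
      qed
      then have "measure_pmf.prob (polya_pick a A xs) T = c"
        using prob_polya_pick[OF assms(1-3) T xs(1)] xs by (simp add: c_def)
      finally show ?thesis using True by simp
    qed
  qed auto
  also have "\<dots> = c * measure_pmf.prob (polya_urn a A (length w)) {xs. map (\<lambda>x. x \<in> S) xs = w}"
    by simp
  also have "\<dots> = pochhammer (a * real (card S)) (count_list (b # w) True) *
    pochhammer (a * real (card A) - a * real (card S)) (count_list (b # w) False) /
    pochhammer (a * real (card A)) (length (b # w))"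
    unfolding Cons c_def cT by (cases b) (simp_all add: pochhammer_Suc mult_ac)
  finally show ?case .
qed

lemma deg_mset_zip:
  assumes "length us = length vs" "set us \<subseteq> A" "set vs \<subseteq> B" "A \<inter> B = {}"
  shows "u \<in> A \<Longrightarrow> deg (mset (zip us vs)) u = count_list us u"
    and "v \<in> B \<Longrightarrow> deg (mset (zip us vs)) v = count_list vs v"
  using assms by (induction us vs rule: list_induct2) (auto simp: deg_def)

text \<open>Since the parts are disjoint, the degree of a vertex is its count in the list of its own
  part; the normalising double sum therefore factorises like the weights.\<close>

lemma edge_pmf_eq_pair_pmf:
  assumes "\<alpha> > 0" "\<beta> > 0" "finite A" "finite B" "A \<noteq> {}" "B \<noteq> {}" "A \<inter> B = {}"
    and "length us = length vs" "set us \<subseteq> A" "set vs \<subseteq> B"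
  shows "edge_pmf \<alpha> \<beta> A B (mset (zip us vs)) = pair_pmf (polya_pick \<alpha> A us) (polya_pick \<beta> B vs)"
proof (rule pmf_eqI)
  fix e :: "'a \<times> 'a"
  obtain u v where e: "e = (u, v)" by (cases e)
  note d = deg_mset_zip[OF assms(8-10,7)]
  have "(\<Sum>(x, y)\<in>A \<times> B. (real (deg (mset (zip us vs)) x) + \<alpha>) * (real (deg (mset (zip us vs)) y) + \<beta>))
     = (\<Sum>x\<in>A. real (count_list us x) + \<alpha>) * (\<Sum>y\<in>B. real (count_list vs y) + \<beta>)"
    by (simp add: sum_product d sum.cartesian_product[symmetric] cong: sum.cong)
  then show "pmf (edge_pmf \<alpha> \<beta> A B (mset (zip us vs))) e = pmf (pair_pmf (polya_pick \<alpha> A us) (polya_pick \<beta> B vs)) e"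
    using assms(1-6) by (simp add: e pmf_edge_pmf edge_prob_def pmf_pair pmf_polya_pick d)
qed

lemma multigraph_process_eq_urns:
  assumes "\<alpha> > 0" "\<beta> > 0" "finite A" "finite B" "A \<noteq> {}" "B \<noteq> {}" "A \<inter> B = {}"
  shows "multigraph_process \<alpha> \<beta> A B t =
    map_pmf (\<lambda>(us, vs). mset (zip us vs)) (pair_pmf (polya_urn \<alpha> A t) (polya_urn \<beta> B t))"
proof (induction t)
  case 0
  then show ?case by (simp add: pair_return_pmf1)
next
  case (Suc t)
  let ?U = "polya_urn \<alpha> A t" and ?V = "polya_urn \<beta> B t"
  have "multigraph_process \<alpha> \<beta> A B (Suc t) = bind_pmf (pair_pmf ?U ?V)
      (\<lambda>p. map_pmf (\<lambda>e. add_mset e (mset (zip (fst p) (snd p)))) (edge_pmf \<alpha> \<beta> A B (mset (zip (fst p) (snd p)))))"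
    by (simp add: Suc bind_map_pmf case_prod_unfold)
  also have "\<dots> = bind_pmf (pair_pmf ?U ?V) (\<lambda>p. map_pmf (\<lambda>e. add_mset e (mset (zip (fst p) (snd p))))
      (pair_pmf (polya_pick \<alpha> A (fst p)) (polya_pick \<beta> B (snd p))))"
    by (intro bind_pmf_cong refl arg_cong2[of _ _ _ _ map_pmf] edge_pmf_eq_pair_pmf assms)
       (auto dest!: subsetD[OF set_polya_urn[OF assms(1,3,5)]] subsetD[OF set_polya_urn[OF assms(2,4,6)]])
  also have "\<dots> = bind_pmf ?U (\<lambda>us. bind_pmf ?V (\<lambda>vs. bind_pmf (polya_pick \<alpha> A us) (\<lambda>u.
      bind_pmf (polya_pick \<beta> B vs) (\<lambda>v. return_pmf (mset (zip (u # us) (v # vs)))))))"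
    by (simp add: pair_pmf_def bind_assoc_pmf bind_return_pmf map_pmf_def)
  \<comment> \<open>The left pick depends on the left history only and may be drawn before the right
    history. This exchange carries independence from a single step to whole histories.\<close>
  also have "\<dots> = bind_pmf ?U (\<lambda>us. bind_pmf (polya_pick \<alpha> A us) (\<lambda>u. bind_pmf ?V (\<lambda>vs.
      bind_pmf (polya_pick \<beta> B vs) (\<lambda>v. return_pmf (mset (zip (u # us) (v # vs)))))))"
    by (intro bind_pmf_cong refl bind_commute_pmf)
  also have "\<dots> = map_pmf (\<lambda>(us, vs). mset (zip us vs)) (pair_pmf (polya_urn \<alpha> A (Suc t)) (polya_urn \<beta> B (Suc t)))"
    by (simp add: pair_pmf_def bind_assoc_pmf bind_return_pmf map_pmf_def)
  finally show ?case .
qed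

section \<open>Covering and cut probabilities\<close>

lemma sum_Pow_card:
  fixes g :: "nat \<Rightarrow> real"
  assumes "finite A"
  shows "(\<Sum>S\<in>Pow A. g (card S)) = (\<Sum>k\<le>card A. real (card A choose k) * g k)"
proof -
  have "(\<Sum>S\<in>Pow A. g (card S)) = (\<Sum>k\<le>card A. \<Sum>S\<in>{S \<in> Pow A. card S = k}. g (card S))"
    using assms by (intro sum.group[symmetric]) (auto intro: card_mono)
  also have "\<dots> = (\<Sum>k\<le>card A. real (card {S. S \<subseteq> A \<and> card S = k}) * g k)"
    by (intro sum.cong refl) (simp add: Pow_def)
  also have "\<dots> = (\<Sum>k\<le>card A. real (card A choose k) * g k)"
    using assms by (simp add: n_subsets)
  finally show ?thesis .
qed

lemma prob_polya_urn_disjoint: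
  assumes "a > 0" "finite A" "A \<noteq> {}" "S \<subseteq> A"
  shows "measure_pmf.prob (polya_urn a A t) {xs. set xs \<inter> S = {}} =
    (\<Prod>j<t. (a * real (card A) - a * real (card S) + real j) / (a * real (card A) + real j))"
proof -
  have "measure_pmf.prob (polya_urn a A t) {xs. set xs \<inter> S = {}}
      = measure_pmf.prob (polya_urn a A t) {xs. map (\<lambda>x. x \<in> S) xs = replicate t False}"
  proof (intro measure_pmf.finite_measure_eq_AE AE_pmfI)
    fix xs assume "xs \<in> set_pmf (polya_urn a A t)"
    then have "length xs = t" using set_polya_urn[OF assms(1-3), of t] by auto
    then have "map (\<lambda>x. x \<in> S) xs = replicate t False \<longleftrightarrow> set xs \<inter> S = {}"
      by (induction xs arbitrary: t) auto
    then show "xs \<in> {xs. set xs \<inter> S = {}} \<longleftrightarrow> xs \<in> {xs. map (\<lambda>x. x \<in> S) xs = replicate t False}" by simp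
  qed auto
  also have "\<dots> = pochhammer (a * real (card A) - a * real (card S)) t / pochhammer (a * real (card A)) t"
  proof -
    have "count_list (replicate n b) c = (if b = c then n else 0)" for n :: nat and b c :: bool
      by (induction n) auto
    then show ?thesis
      using prob_polya_urn_pattern[OF assms, of "replicate t False"] by simp
  qed
  finally show ?thesis by (simp add: pochhammer_ratio_eq_prod)
qed

lemma prob_polya_urn_covers:
  assumes "a > 0" "finite A" "A \<noteq> {}"
  shows "measure_pmf.prob (polya_urn a A t) {xs. A \<subseteq> set xs} =
    (\<Sum>k\<le>card A. (-1) ^ k * (real (card A choose k) *
      (\<Prod>j<t. (a * real (card A) - a * real k + real j) / (a * real (card A) + real j))))"
proof -
  let ?U = "polya_urn a A t"
  have ind: "indicator {xs. A \<subseteq> set xs} xs = (\<Sum>S\<in>Pow A. (-1) ^ card S * indicator {xs. set xs \<inter> S = {}} xs :: real)"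
    for xs
  proof -
    \<comment> \<open>Inclusion and exclusion as the expansion of the product over \<open>x\<close>
      of one minus the indicator that \<open>x\<close> is missed: the subset \<open>S\<close>
      collects the factors from which the indicator is chosen.\<close>
    have "indicator {xs. A \<subseteq> set xs} xs = (\<Prod>x\<in>A. - (if x \<in> set xs then 0 else 1) + 1 :: real)"
      using assms by (auto simp: indicator_def prod_zero_iff intro!: prod.neutral)
    also have "\<dots> = (\<Sum>S\<in>Pow A. (\<Prod>x\<in>S. - (if x \<in> set xs then 0 else 1)) * (\<Prod>x\<in>A - S. 1))"
      by (rule prod_add) fact
    also have "\<dots> = (\<Sum>S\<in>Pow A. (-1) ^ card S * indicator {xs. set xs \<inter> S = {}} xs)"
    proof (intro sum.cong refl)
      fix S assume "S \<in> Pow A"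
      then have "finite S" using assms finite_subset by auto
      have "(\<Prod>x\<in>S. - (if x \<in> set xs then 0 else 1 :: real)) = (\<Prod>x\<in>S. (-1) * (if x \<in> set xs then 0 else 1 :: real))"
        by (intro prod.cong) auto
      also have "\<dots> = (-1) ^ card S * indicator {xs. set xs \<inter> S = {}} xs"
        using \<open>finite S\<close> by (subst prod.distrib) (auto simp: indicator_def prod_zero_iff intro!: prod.neutral)
      finally show "(\<Prod>x\<in>S. - (if x \<in> set xs then 0 else 1 :: real)) * (\<Prod>x\<in>A - S. 1)
          = (-1) ^ card S * indicator {xs. set xs \<inter> S = {}} xs" by simp
    qed
    finally show ?thesis .
  qed
  have "measure_pmf.prob ?U {xs. A \<subseteq> set xs} = measure_pmf.expectation ?U (indicator {xs. A \<subseteq> set xs})"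
    by simp
  also have "\<dots> = measure_pmf.expectation ?U (\<lambda>xs. \<Sum>S\<in>Pow A. (-1) ^ card S * indicator {xs. set xs \<inter> S = {}} xs)"
    by (rule Bochner_Integration.integral_cong[OF refl ind])
  also have "\<dots> = (\<Sum>S\<in>Pow A. (-1) ^ card S * measure_pmf.prob ?U {xs. set xs \<inter> S = {}})"
    by (subst Bochner_Integration.integral_sum)
       (auto intro!: measure_pmf.integrable_const_bound[where B = 1] split: split_indicator)
  also have "\<dots> = (\<Sum>S\<in>Pow A. (\<lambda>k. (-1) ^ k *
      (\<Prod>j<t. (a * real (card A) - a * real k + real j) / (a * real (card A) + real j))) (card S))"
    using assms by (intro sum.cong) (auto simp: prob_polya_urn_disjoint)
  also have "\<dots> = (\<Sum>k\<le>card A. (-1) ^ k * (real (card A choose k) *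
      (\<Prod>j<t. (a * real (card A) - a * real k + real j) / (a * real (card A) + real j))))"
    using assms by (subst sum_Pow_card) (auto simp: mult_ac)
  finally show ?thesis .
qed

section \<open>Hit words and the union over cuts\<close>

lemma prob_pair_pmf_Times:
  "measure_pmf.prob (pair_pmf M N) (X \<times> Y) = measure_pmf.prob M X * measure_pmf.prob N Y"
proof -
  have "measure_pmf.prob (pair_pmf M N) (X \<times> Y) =
      measure_pmf.prob (pair_pmf M N) ((X \<inter> set_pmf M) \<times> (Y \<inter> set_pmf N))"
    by (intro measure_pmf.finite_measure_eq_AE AE_pmfI) auto
  also have "\<dots> = measure_pmf.prob M (X \<inter> set_pmf M) * measure_pmf.prob N (Y \<inter> set_pmf N)"
    by (intro measure_pmf_prob_product) auto
  finally show ?thesis by (simp add: measure_Int_set_pmf)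
qed

definition patterns :: "nat \<Rightarrow> nat \<Rightarrow> bool list set" where
  "patterns t k = {w. length w = t \<and> count_list w True = k}"

lemma finite_patterns [simp]: "finite (patterns t k)"
  by (rule finite_subset[OF _ finite_lists_length_eq[of UNIV t]]) (auto simp: patterns_def)

lemma card_patterns: "card (patterns t k) = t choose k"
proof (induction t arbitrary: k)
  case 0
  have "patterns 0 k = (if k = 0 then {[]} else {})" by (auto simp: patterns_def)
  then show ?case by simp
next
  case (Suc t)
  have "patterns (Suc t) k = (#) False ` patterns t k \<union> (if k = 0 then {} else (#) True ` patterns t (k - 1))"
    (is "_ = ?R")
  proof (intro set_eqI)
    fix w show "w \<in> patterns (Suc t) k \<longleftrightarrow> w \<in> ?R"
      by (cases w; cases k; cases "hd w") (auto simp: patterns_def)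
  qed
  moreover have "(#) False ` X \<inter> (#) True ` Y = {}" for X Y by auto
  ultimately show ?case
    by (cases k) (auto simp: card_Un_disjoint card_image Suc)
qed

lemma count_list_bool:
  fixes w :: "bool list"
  shows "count_list w False = length w - count_list w True"
proof -
  have "count_list w True + count_list w False = length w" by (induction w) auto
  then show ?thesis by simp
qed

text \<open>The mass of one single word with \<open>k\<close> hits on a set of \<open>s\<close>
  among \<open>n\<close> vertices. Multiplied by \<open>t choose k\<close> it becomes the
  beta-binomial mass of \<open>k\<close>.\<close>

definition pattern_prob :: "real \<Rightarrow> nat \<Rightarrow> nat \<Rightarrow> nat \<Rightarrow> nat \<Rightarrow> real" where
  "pattern_prob a n s t k = pochhammer (a * real s) k * pochhammer (a * real n - a * real s) (t - k) /
     pochhammer (a * real n) t"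

lemma prob_patterns:
  assumes "a > 0" "finite A" "A \<noteq> {}" "S \<subseteq> A" "w \<in> patterns t k"
  shows "measure_pmf.prob (polya_urn a A t) {xs. map (\<lambda>x. x \<in> S) xs = w} = pattern_prob a (card A) (card S) t k"
  using prob_polya_urn_pattern[OF assms(1-4), of w] assms(5)
  by (simp add: patterns_def pattern_prob_def count_list_bool)

lemma pattern_prob_nonneg:
  assumes "a > 0" "s \<le> n"
  shows "pattern_prob a n s t k \<ge> 0"
  using assms unfolding pattern_prob_def pochhammer_prod
  by (auto intro!: divide_nonneg_nonneg mult_nonneg_nonneg prod_nonneg)

text \<open>A partial sum of a beta-binomial law. The bound comes from disjointness of the events
  belonging to different words, which avoids a Vandermonde identity for rising factorials.\<close>

lemma sum_pattern_prob_le_1: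
  assumes "a > 0" "finite A" "A \<noteq> {}" "S \<subseteq> A" "finite K"
  shows "(\<Sum>k\<in>K. real (t choose k) * pattern_prob a (card A) (card S) t k) \<le> 1"
proof -
  let ?U = "polya_urn a A t"
  have "(\<Sum>k\<in>K. real (t choose k) * pattern_prob a (card A) (card S) t k)
     = (\<Sum>k\<in>K. \<Sum>w\<in>patterns t k. measure_pmf.prob ?U {xs. map (\<lambda>x. x \<in> S) xs = w})"
    using assms by (intro sum.cong refl) (simp add: prob_patterns card_patterns)
  also have "\<dots> = (\<Sum>w\<in>(\<Union>k\<in>K. patterns t k). measure_pmf.prob ?U {xs. map (\<lambda>x. x \<in> S) xs = w})"
    using assms by (intro sum.UNION_disjoint[symmetric] ballI impI finite_patterns) (auto simp: patterns_def)
  also have "\<dots> = measure_pmf.prob ?U (\<Union>w\<in>(\<Union>k\<in>K. patterns t k). {xs. map (\<lambda>x. x \<in> S) xs = w})"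
    using assms by (intro measure_pmf.finite_measure_finite_Union[symmetric]) (auto simp: disjoint_family_on_def)
  also have "\<dots> \<le> 1" by simp
  finally show ?thesis .
qed

text \<open>
  The bounds \<open>card S \<le> k\<close> and \<open>card T \<le> k\<close> encode the absence of isolated vertices; \<open>2 * k \<le> t\<close>
  can be assumed after passing to the complementary cut.
\<close>

definition split_event :: "'v set \<Rightarrow> 'v set \<Rightarrow> nat \<Rightarrow> ('v list \<times> 'v list) set" where
  "split_event A B t = {(us, vs). \<exists>S T k. S \<subseteq> A \<and> T \<subseteq> B \<and> card S \<le> k \<and> card T \<le> k \<and> 1 \<le> k \<and> 2 * k \<le> t \<and>
     map (\<lambda>x. x \<in> S) us = map (\<lambda>x. x \<in> T) vs \<and> map (\<lambda>x. x \<in> S) us \<in> patterns t k}"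

text \<open>For fixed \<open>S\<close>, \<open>T\<close> and \<open>k\<close>, the common word can
  be chosen in \<open>t choose k\<close> ways, and independence makes each choice a product of two
  word probabilities. The product of the two hit-count probabilities would carry this binomial
  coefficient twice; the missing factor is the gain from requiring equal words.\<close>

lemma prob_split_event_le:
  fixes A B :: "'v set"
  assumes "\<alpha> > 0" "\<beta> > 0" "finite A" "finite B" "A \<noteq> {}" "B \<noteq> {}"
  shows "measure_pmf.prob (pair_pmf (polya_urn \<alpha> A t) (polya_urn \<beta> B t)) (split_event A B t) \<le>
    (\<Sum>k\<in>{1..t div 2}. \<Sum>S | S \<subseteq> A \<and> card S \<le> k. \<Sum>T | T \<subseteq> B \<and> card T \<le> k.
       real (t choose k) * (pattern_prob \<alpha> (card A) (card S) t k * pattern_prob \<beta> (card B) (card T) t k))"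
proof -
  let ?P = "pair_pmf (polya_urn \<alpha> A t) (polya_urn \<beta> B t)"
  define E where "E = (\<lambda>(S :: 'v set) (T :: 'v set) w. {us. map (\<lambda>x. x \<in> S) us = w} \<times> {vs. map (\<lambda>x. x \<in> T) vs = (w :: bool list)})"
  define E' where "E' = (\<lambda>k. \<Union>S\<in>{S. S \<subseteq> A \<and> card S \<le> k}. \<Union>T\<in>{T. T \<subseteq> B \<and> card T \<le> k}. \<Union>w\<in>patterns t k. E S T w)"
  have fin: "finite {S. S \<subseteq> A \<and> card S \<le> k}" "finite {T. T \<subseteq> B \<and> card T \<le> k}" for k
    using assms by auto
  have "split_event A B t \<subseteq> (\<Union>k\<in>{1..t div 2}. E' k)"
  proof
    fix p assume "p \<in> split_event A B t"
    then obtain us vs S T k where p: "p = (us, vs)" "S \<subseteq> A" "T \<subseteq> B" "card S \<le> k" "card T \<le> k" "1 \<le> k" "2 * k \<le> t"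
       "map (\<lambda>x. x \<in> S) us = map (\<lambda>x. x \<in> T) vs" "map (\<lambda>x. x \<in> S) us \<in> patterns t k"
      unfolding split_event_def by blast
    then have "p \<in> E S T (map (\<lambda>x. x \<in> S) us)" by (simp add: E_def)
    with p have "p \<in> E' k" unfolding E'_def by blast
    moreover have "k \<in> {1..t div 2}" using p by auto
    ultimately show "p \<in> (\<Union>k\<in>{1..t div 2}. E' k)" by blast
  qed
  then have "measure_pmf.prob ?P (split_event A B t) \<le> measure_pmf.prob ?P (\<Union>k\<in>{1..t div 2}. E' k)"
    by (intro measure_pmf.finite_measure_mono) auto
  also have "\<dots> \<le> (\<Sum>k\<in>{1..t div 2}. measure_pmf.prob ?P (E' k))"
    by (intro measure_pmf.finite_measure_subadditive_finite) auto
  also have "\<dots> \<le> (\<Sum>k\<in>{1..t div 2}. \<Sum>S | S \<subseteq> A \<and> card S \<le> k. \<Sum>T | T \<subseteq> B \<and> card T \<le> k.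
       \<Sum>w\<in>patterns t k. measure_pmf.prob ?P (E S T w))"
    unfolding E'_def using fin
    by (intro sum_mono order.trans[OF measure_pmf.finite_measure_subadditive_finite] fin) auto
  also have "\<dots> = (\<Sum>k\<in>{1..t div 2}. \<Sum>S | S \<subseteq> A \<and> card S \<le> k. \<Sum>T | T \<subseteq> B \<and> card T \<le> k.
       real (t choose k) * (pattern_prob \<alpha> (card A) (card S) t k * pattern_prob \<beta> (card B) (card T) t k))"
  proof (intro sum.cong refl)
    fix k S T assume *: "S \<in> {S. S \<subseteq> A \<and> card S \<le> k}" "T \<in> {T. T \<subseteq> B \<and> card T \<le> k}"
    have "measure_pmf.prob ?P (E S T w) = pattern_prob \<alpha> (card A) (card S) t k * pattern_prob \<beta> (card B) (card T) t k"
      if "w \<in> patterns t k" for w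
    proof -
      have "measure_pmf.prob ?P (E S T w) = measure_pmf.prob (polya_urn \<alpha> A t) {xs. map (\<lambda>x. x \<in> S) xs = w} *
          measure_pmf.prob (polya_urn \<beta> B t) {xs. map (\<lambda>x. x \<in> T) xs = w}"
        unfolding E_def by (rule prob_pair_pmf_Times)
      then show ?thesis using that * assms by (simp add: prob_patterns)
    qed
    then show "(\<Sum>w\<in>patterns t k. measure_pmf.prob ?P (E S T w)) =
       real (t choose k) * (pattern_prob \<alpha> (card A) (card S) t k * pattern_prob \<beta> (card B) (card T) t k)"
      by (simp add: card_patterns)
  qed
  finally show ?thesis .
qed

section \<open>Connectedness and cuts\<close>

text \<open>The form used from here on: reachability along the symmetrised edge set is monotone in
  the edges, and its classes supply the cuts.\<close>

lemma is_connected_iff: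
  "is_connected A B M \<longleftrightarrow> A \<union> B \<noteq> {} \<and>
    (\<forall>u\<in>A \<union> B. \<forall>v\<in>A \<union> B. (u, v) \<in> rtrancl_on (A \<union> B) (symcl (set_mset M)))"
proof -
  have "arcs_ends (graph_of A B M) = set_mset M"
    by (auto simp: graph_of_def arcs_ends_def arc_to_ends_def)
  moreover have "parcs (mk_symmetric (graph_of A B M)) = symcl (arcs_ends (graph_of A B M))"
    by (auto simp: parcs_mk_symmetric symcl_def arcs_ends_conv)
  ultimately show ?thesis
    by (simp add: is_connected_def connected_def strongly_connected_def reachable_def graph_of_def)
qed

lemma rtrancl_on_mono_rel:
  assumes "(u, v) \<in> rtrancl_on F r" "r \<subseteq> s"
  shows "(u, v) \<in> rtrancl_on F s"
  using assms by (induction rule: rtrancl_on_induct) (auto intro: rtrancl_on_into_rtrancl_on)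

lemma is_connected_add_mset:
  assumes "is_connected A B M"
  shows "is_connected A B (add_mset e M)"
proof -
  have "symcl (set_mset M) \<subseteq> symcl (set_mset (add_mset e M))" by (auto simp: symcl_def)
  with assms show ?thesis unfolding is_connected_iff by (blast intro: rtrancl_on_mono_rel)
qed

lemma is_connected_incident:
  assumes "is_connected A B M" "u \<in> A \<union> B" "v \<in> A \<union> B" "u \<noteq> v"
  shows "\<exists>w. (u, w) \<in> set_mset M \<or> (w, u) \<in> set_mset M"
proof -
  \<comment> \<open>The path is taken towards \<open>u\<close>, so that the case rule exposes its
    last edge, which is incident to \<open>u\<close>.\<close>
  have "(v, u) \<in> rtrancl_on (A \<union> B) (symcl (set_mset M))"
    using assms by (auto simp: is_connected_iff)
  then show ?thesis using assms(4)
    by (cases rule: rtrancl_on.cases) (auto simp: symcl_def)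
qed

lemma connected_imp_covered:
  assumes "is_connected A B (mset (zip us vs))" "A \<inter> B = {}" "A \<noteq> {}" "B \<noteq> {}"
    "set us \<subseteq> A" "set vs \<subseteq> B"
  shows "A \<subseteq> set us" "B \<subseteq> set vs"
proof -
  show "A \<subseteq> set us"
  proof
    fix u assume u: "u \<in> A"
    obtain v where "v \<in> B" using assms by auto
    then have "\<exists>w. (u, w) \<in> set (zip us vs) \<or> (w, u) \<in> set (zip us vs)"
      using is_connected_incident[OF assms(1), of u v] u assms by auto
    then show "u \<in> set us" using u assms by (auto dest: set_zip_leftD set_zip_rightD)
  qed
  show "B \<subseteq> set vs"
  proof
    fix v assume v: "v \<in> B"
    obtain u where "u \<in> A" using assms by auto
    then have "\<exists>w. (v, w) \<in> set (zip us vs) \<or> (w, v) \<in> set (zip us vs)"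
      using is_connected_incident[OF assms(1), of v u] v assms by auto
    then show "v \<in> set vs" using v assms by (auto dest: set_zip_leftD set_zip_rightD)
  qed
qed

lemma not_connected_cut:
  assumes "\<not> is_connected A B M" "A \<noteq> {}"
  obtains C x y where "C \<subseteq> A \<union> B" "x \<in> C" "y \<in> (A \<union> B) - C"
    "\<And>u v. (u, v) \<in> set_mset M \<Longrightarrow> u \<in> A \<union> B \<Longrightarrow> v \<in> A \<union> B \<Longrightarrow> u \<in> C \<longleftrightarrow> v \<in> C"
proof -
  let ?R = "rtrancl_on (A \<union> B) (symcl (set_mset M))"
  obtain x y where xy: "x \<in> A \<union> B" "y \<in> A \<union> B" "(x, y) \<notin> ?R"
    using assms by (auto simp: is_connected_iff)
  show thesis
  proof (rule that[of "{z \<in> A \<union> B. (x, z) \<in> ?R}" x y])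
    fix u v assume *: "(u, v) \<in> set_mset M" "u \<in> A \<union> B" "v \<in> A \<union> B"
    then have "(u, v) \<in> symcl (set_mset M)" "(v, u) \<in> symcl (set_mset M)"
      by (auto simp: symcl_def)
    then show "u \<in> {z \<in> A \<union> B. (x, z) \<in> ?R} \<longleftrightarrow> v \<in> {z \<in> A \<union> B. (x, z) \<in> ?R}"
      using * by (auto intro: rtrancl_on_into_rtrancl_on)
  qed (use xy in auto)
qed

lemma card_le_count_True:
  assumes "S \<subseteq> set xs"
  shows "card S \<le> count_list (map (\<lambda>x. x \<in> S) xs) True"
proof -
  have "count_list (map (\<lambda>x. x \<in> S) xs) True = length (filter (\<lambda>x. x \<in> S) xs)"
    by (induction xs) auto
  moreover have "S = set (filter (\<lambda>x. x \<in> S) xs)" using assms by auto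
  ultimately show ?thesis using card_length[of "filter (\<lambda>x. x \<in> S) xs"] by simp
qed

text \<open>Each edge joins the left and the right vertex drawn at the same time. If no edge crosses
  a cut, simultaneous draws lie on the same side of it, so the left and right hit words agree. Since
  every vertex is drawn, each part of a side has at most as many vertices as the side has
  hits.\<close>

lemma not_connected_imp_split:
  assumes "\<not> is_connected A B (mset (zip us vs))" "A \<inter> B = {}" "A \<noteq> {}"
    "set us = A" "set vs = B" "length us = t" "length vs = t"
  shows "(us, vs) \<in> split_event A B t"
proof -
  obtain C x y where C: "C \<subseteq> A \<union> B" "x \<in> C" "y \<in> (A \<union> B) - C"
    "\<And>u v. (u, v) \<in> set_mset (mset (zip us vs)) \<Longrightarrow> u \<in> A \<union> B \<Longrightarrow> v \<in> A \<union> B \<Longrightarrow> u \<in> C \<longleftrightarrow> v \<in> C"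
    using not_connected_cut[OF assms(1,3)] by blast
  \<comment> \<open>\<open>D\<close> stands for either side of the cut; it will be the one that
    receives at most half of the draws.\<close>
  have key: "(us, vs) \<in> split_event A B t"
    if D: "D \<subseteq> A \<union> B" "z \<in> D" "\<And>u v. (u, v) \<in> set (zip us vs) \<Longrightarrow> u \<in> D \<longleftrightarrow> v \<in> D"
      and k: "2 * count_list (map (\<lambda>x. x \<in> D) us) True \<le> t" for D z
  proof -
    define S T where "S = D \<inter> A" and "T = D \<inter> B"
    define k where "k = count_list (map (\<lambda>x. x \<in> S) us) True"
    have mu: "map (\<lambda>x. x \<in> S) us = map (\<lambda>x. x \<in> D) us"
      using assms by (auto simp: S_def)
    have mv: "map (\<lambda>x. x \<in> T) vs = map (\<lambda>x. x \<in> D) vs"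
      using assms by (auto simp: T_def)
    have eq: "map (\<lambda>x. x \<in> D) us = map (\<lambda>x. x \<in> D) vs"
      using assms(6,7) D(3)
      by (intro nth_equalityI) (auto simp: set_zip)
    have cS: "card S \<le> k" unfolding k_def
      using assms by (intro card_le_count_True) (auto simp: S_def)
    have cT: "card T \<le> k" unfolding k_def mu eq mv[symmetric]
      using assms by (intro card_le_count_True) (auto simp: T_def)
    have "finite S" "finite T" using assms by (auto simp: S_def T_def)
    moreover have "S \<noteq> {} \<or> T \<noteq> {}" using D by (auto simp: S_def T_def)
    ultimately have "1 \<le> k" using cS cT
      by (metis card_gt_0_iff less_one linorder_not_le order_less_le_trans)
    moreover have "2 * k \<le> t" using k by (simp add: k_def mu)
    moreover have "map (\<lambda>x. x \<in> S) us \<in> patterns t k"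
      using assms by (simp add: patterns_def k_def)
    moreover have "S \<subseteq> A" "T \<subseteq> B" by (auto simp: S_def T_def)
    moreover have "map (\<lambda>x. x \<in> S) us = map (\<lambda>x. x \<in> T) vs" using mu mv eq by simp
    ultimately show ?thesis
      unfolding split_event_def mem_Collect_eq prod.case using cS cT by blast
  qed
  have inAB: "u \<in> A \<union> B \<and> v \<in> A \<union> B" if "(u, v) \<in> set (zip us vs)" for u v
    using that assms by (auto dest: set_zip_leftD set_zip_rightD)
  have C': "u \<in> C \<longleftrightarrow> v \<in> C" if "(u, v) \<in> set (zip us vs)" for u v
    using C(4)[of u v] inAB[OF that] that by simp
  show ?thesis
  proof (cases "2 * count_list (map (\<lambda>x. x \<in> C) us) True \<le> t")
    case True
    then show ?thesis using key[OF C(1,2) C'] by blast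
  next
    case False
    define D where "D = (A \<union> B) - C"
    have mD: "map (\<lambda>x. x \<in> D) us = map (\<lambda>x. x \<notin> C) us" using assms by (auto simp: D_def)
    have "count_list (map (\<lambda>x. x \<in> C) us) True + count_list (map (\<lambda>x. x \<notin> C) us) True = length us"
      by (induction us) auto
    then have "2 * count_list (map (\<lambda>x. x \<in> D) us) True \<le> t"
      unfolding mD using False assms(6) by linarith
    moreover have "D \<subseteq> A \<union> B" "y \<in> D" using C by (auto simp: D_def)
    moreover have "u \<in> D \<longleftrightarrow> v \<in> D" if "(u, v) \<in> set (zip us vs)" for u v
      using C'[OF that] inAB[OF that] by (auto simp: D_def)
    ultimately show ?thesis using key[of D y] by blast
  qed
qed

section \<open>Monotonicity in time and comparison with covering\<close>

lemma prob_connected_mono: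
  assumes "s \<le> t"
  shows "measure_pmf.prob (multigraph_process \<alpha> \<beta> A B s) {M. is_connected A B M}
    \<le> measure_pmf.prob (multigraph_process \<alpha> \<beta> A B t) {M. is_connected A B M}"
  using assms
proof (induction rule: dec_induct)
  case (step t)
  let ?X = "{M. is_connected A B M}"
  have "measure_pmf.prob (multigraph_process \<alpha> \<beta> A B t) ?X
     = measure_pmf.expectation (multigraph_process \<alpha> \<beta> A B t) (indicator ?X)" by simp
  also have "\<dots> \<le> measure_pmf.expectation (multigraph_process \<alpha> \<beta> A B t)
      (\<lambda>M. measure_pmf.prob (map_pmf (\<lambda>e. add_mset e M) (edge_pmf \<alpha> \<beta> A B M)) ?X)"
  proof (intro integral_mono)
    fix M
    show "indicator ?X M \<le> measure_pmf.prob (map_pmf (\<lambda>e. add_mset e M) (edge_pmf \<alpha> \<beta> A B M)) ?X"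
    proof (cases "is_connected A B M")
      case True
      then have "(\<lambda>e. add_mset e M) -` ?X = UNIV" by (auto intro: is_connected_add_mset)
      then show ?thesis by simp
    qed simp
  qed (auto intro!: measure_pmf.integrable_const_bound[where B = 1])
  also have "\<dots> = measure_pmf.prob (multigraph_process \<alpha> \<beta> A B (Suc t)) ?X"
    by (simp add: prob_bind_pmf)
  finally show ?case using step by linarith
qed simp

text \<open>A connected graph has no isolated vertex, and a disconnected one without isolated
  vertices lies in the split event. Hence \<open>c\<close>, the probability that no vertex is
  isolated, differs from \<open>p\<close> by at most what the union bound controls.\<close>

lemma prob_connected_bounds:
  fixes \<alpha> \<beta> :: real and A B :: "'v set" and t :: nat
  assumes "\<alpha> > 0" "\<beta> > 0" "finite A" "finite B" "A \<noteq> {}" "B \<noteq> {}" "A \<inter> B = {}"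
  defines "c \<equiv> measure_pmf.prob (polya_urn \<alpha> A t) {us. A \<subseteq> set us} *
      measure_pmf.prob (polya_urn \<beta> B t) {vs. B \<subseteq> set vs}"
    and "p \<equiv> measure_pmf.prob (multigraph_process \<alpha> \<beta> A B t) {M. is_connected A B M}"
  shows "p \<le> c"
    and "c \<le> p + measure_pmf.prob (pair_pmf (polya_urn \<alpha> A t) (polya_urn \<beta> B t)) (split_event A B t)"
proof -
  let ?P = "pair_pmf (polya_urn \<alpha> A t) (polya_urn \<beta> B t)"
  define G where "G = {(us, vs). is_connected A B (mset (zip us vs))}"
  have p: "p = measure_pmf.prob ?P G"
    unfolding p_def multigraph_process_eq_urns[OF assms(1-7)]
    by (auto simp: G_def intro!: arg_cong[of _ _ "measure_pmf.prob _"])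
  have c: "c = measure_pmf.prob ?P ({us. A \<subseteq> set us} \<times> {vs. B \<subseteq> set vs})"
    unfolding c_def by (rule prob_pair_pmf_Times[symmetric])
  note supp = subsetD[OF set_polya_urn[OF assms(1,3,5), of t]] subsetD[OF set_polya_urn[OF assms(2,4,6), of t]]
  show "p \<le> c"
    unfolding p c
  proof (intro measure_pmf.finite_measure_mono_AE AE_pmfI impI)
    fix q assume q: "q \<in> set_pmf ?P" "q \<in> G"
    obtain us vs where "q = (us, vs)" by (cases q)
    with q show "q \<in> {us. A \<subseteq> set us} \<times> {vs. B \<subseteq> set vs}"
      using connected_imp_covered[of A B us vs] assms(5-7) by (auto simp: G_def dest!: supp)
  qed auto
  have "c \<le> measure_pmf.prob ?P (G \<union> split_event A B t)"
    unfolding c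
  proof (intro measure_pmf.finite_measure_mono_AE AE_pmfI impI)
    fix q assume q: "q \<in> set_pmf ?P" "q \<in> {us. A \<subseteq> set us} \<times> {vs. B \<subseteq> set vs}"
    obtain us vs where uv: "q = (us, vs)" by (cases q)
    have "set us = A" "set vs = B" "length us = t" "length vs = t"
      using q supp uv by auto
    then show "q \<in> G \<union> split_event A B t"
      using not_connected_imp_split[of A B us vs t] assms(5,7) uv by (auto simp: G_def)
  qed auto
  also have "\<dots> \<le> measure_pmf.prob ?P G + measure_pmf.prob ?P (split_event A B t)"
    by (intro measure_Un_le) auto
  finally show "c \<le> p + measure_pmf.prob ?P (split_event A B t)" by (simp add: p)
qed

section \<open>The union bound\<close>

text \<open>A set of size \<open>s\<close> costs \<open>x ^ s\<close> up to the exponential factor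
  in \<open>k\<close>, and there are at most \<open>card A ^ s\<close> such sets. In the critical
  window \<open>card A * x\<close> stays bounded by a constant \<open>d\<close>, so each size
  contributes at most \<open>d ^ k\<close>, using that \<open>s\<close> is at most
  \<open>k\<close>.\<close>

lemma sum_pattern_prob_le:
  fixes a d x :: real and A :: "'v set" and e k t :: nat
  defines "x \<equiv> (2 * a * real (card A) / real t) powr a"
  assumes a: "a > 0" "finite A" "1 \<le> a * real (card A)"
    and e: "a \<le> real e" and d: "1 \<le> d" "real (card A) * x \<le> d"
    and k: "1 \<le> k" "2 * k \<le> t"
  shows "(\<Sum>S | S \<subseteq> A \<and> card S \<le> k. real (t choose k) * pattern_prob a (card A) (card S) t k)
    \<le> (2 * d * 2 ^ (e + 1)) ^ k"
proof -
  let ?n = "card A"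
  have n0: "real ?n > 0" using a(3) by (cases "?n = 0") auto
  have x0: "x > 0" unfolding x_def using n0 a k by (intro powr_gt_zero[THEN iffD2]) auto
  have single: "real (t choose k) * pattern_prob a ?n s t k \<le> x ^ s * (2 ^ (e + 1)) ^ k"
    if "s \<le> ?n" "s \<le> k" for s
  proof -
    \<comment> \<open>Here the absence of isolated vertices pays off: at least as many hits as
      vertices keeps the cost of the hits exponential in \<open>k\<close>.\<close>
    have "a * real s \<le> real e * real k"
      using that a e by (intro mult_mono) auto
    then have "real ((k + (t - k)) choose k) * (pochhammer (a * real s) k * pochhammer (a * real ?n - a * real s) (t - k) /
        pochhammer (a * real ?n) (k + (t - k)))
      \<le> (a * real ?n / (a * real ?n + real (t - k))) powr (a * real s) * (2 ^ (e + 1)) ^ k"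
      using a that by (intro beta_binomial_bound) auto
    then have "real (t choose k) * pattern_prob a ?n s t k
      \<le> (a * real ?n / (a * real ?n + real (t - k))) powr (a * real s) * (2 ^ (e + 1)) ^ k"
      using k by (simp add: pattern_prob_def)
    also have "\<dots> \<le> (2 * a * real ?n / real t) powr (a * real s) * (2 ^ (e + 1)) ^ k"
    proof -
      \<comment> \<open>At most half of the draws are hits, so at least \<open>t / 2\<close> are
        misses. This is the origin of the factor 2 in \<open>x\<close>.\<close>
      have "real t \<le> 2 * (a * real ?n + real (t - k))" using k a by (simp add: of_nat_diff)
      then have "a * real ?n / (a * real ?n + real (t - k)) \<le> a * real ?n / (real t / 2)"
        using a k by (intro divide_left_mono) auto
      then show ?thesis
        using a by (intro mult_right_mono powr_mono2) (auto simp: mult_ac)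
    qed
    also have "(2 * a * real ?n / real t) powr (a * real s) = x ^ s"
      using x0 by (simp add: x_def powr_powr[symmetric] powr_realpow)
    finally show ?thesis .
  qed
  have fin: "finite {S. S \<subseteq> A \<and> card S \<le> k}" using a by auto
  have "(\<Sum>S | S \<subseteq> A \<and> card S \<le> k. real (t choose k) * pattern_prob a ?n (card S) t k)
      \<le> (\<Sum>S | S \<subseteq> A \<and> card S \<le> k. x ^ card S * (2 ^ (e + 1)) ^ k)"
    using a by (intro sum_mono single) (auto intro: card_mono)
  also have "\<dots> = (\<Sum>s\<le>k. \<Sum>S\<in>{S \<in> {S. S \<subseteq> A \<and> card S \<le> k}. card S = s}. x ^ card S * (2 ^ (e + 1)) ^ k)"
    using fin by (intro sum.group[symmetric]) auto
  also have "\<dots> = (\<Sum>s\<le>k. real (card {S. S \<subseteq> A \<and> card S = s}) * (x ^ s * (2 ^ (e + 1)) ^ k))"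
  proof (intro sum.cong refl)
    fix s assume "s \<in> {..k}"
    then have "{S \<in> {S. S \<subseteq> A \<and> card S \<le> k}. card S = s} = {S. S \<subseteq> A \<and> card S = s}" by auto
    then show "(\<Sum>S\<in>{S \<in> {S. S \<subseteq> A \<and> card S \<le> k}. card S = s}. x ^ card S * (2 ^ (e + 1)) ^ k)
      = real (card {S. S \<subseteq> A \<and> card S = s}) * (x ^ s * (2 ^ (e + 1)) ^ k)" by simp
  qed
  also have "\<dots> \<le> (\<Sum>s\<le>k. d ^ k * (2 ^ (e + 1)) ^ k)"
  proof (intro sum_mono)
    fix s assume s: "s \<in> {..k}"
    have "?n choose s \<le> ?n ^ s"
      by (cases "s \<le> ?n") (auto simp: binomial_le_pow binomial_eq_0)
    then have "real (card {S. S \<subseteq> A \<and> card S = s}) \<le> real ?n ^ s"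
      using a by (simp add: n_subsets flip: of_nat_power)
    then have "real (card {S. S \<subseteq> A \<and> card S = s}) * x ^ s \<le> real ?n ^ s * x ^ s"
      using x0 by (intro mult_right_mono) auto
    also have "\<dots> = (real ?n * x) ^ s" by (simp add: power_mult_distrib)
    also have "\<dots> \<le> d ^ s" using d x0 by (intro power_mono) auto
    also have "\<dots> \<le> d ^ k" using d s by (intro power_increasing) auto
    finally have "real (card {S. S \<subseteq> A \<and> card S = s}) * x ^ s * (2 ^ (e + 1)) ^ k \<le> d ^ k * (2 ^ (e + 1)) ^ k"
      by (intro mult_right_mono) auto
    then show "real (card {S. S \<subseteq> A \<and> card S = s}) * (x ^ s * (2 ^ (e + 1)) ^ k) \<le> d ^ k * (2 ^ (e + 1)) ^ k"
      by (simp add: mult.assoc)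
  qed
  also have "\<dots> = real (Suc k) * (d * 2 ^ (e + 1)) ^ k" by (simp add: power_mult_distrib)
  \<comment> \<open>The number \<open>k + 1\<close> of possible sizes is absorbed into the power,
    which puts the leading 2 into the final base.\<close>
  also have "\<dots> \<le> 2 ^ k * (d * 2 ^ (e + 1)) ^ k"
  proof (intro mult_right_mono)
    have "real (Suc k) \<le> real (2 ^ k)" by (intro of_nat_mono Suc_leI less_exp)
    then show "real (Suc k) \<le> 2 ^ k" by simp
  qed (use d in auto)
  also have "\<dots> = (2 * d * 2 ^ (e + 1)) ^ k"
    by (simp only: power_mult_distrib[symmetric] mult.assoc)
  finally show ?thesis .
qed

lemma sum_power_le_twice:
  fixes \<epsilon> :: real
  assumes "0 \<le> \<epsilon>" "2 * \<epsilon> \<le> 1"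
  shows "(\<Sum>k\<in>{1..n}. \<epsilon> ^ k) \<le> 2 * \<epsilon>"
proof -
  \<comment> \<open>A bound for the tail is added on the left so that the induction closes.\<close>
  have "(\<Sum>k\<in>{1..n}. \<epsilon> ^ k) + 2 * \<epsilon> ^ Suc n \<le> 2 * \<epsilon>"
  proof (induction n)
    case (Suc n)
    have "2 * \<epsilon> * \<epsilon> ^ Suc n \<le> 1 * \<epsilon> ^ Suc n" using assms by (intro mult_right_mono) auto
    then have "2 * \<epsilon> ^ Suc (Suc n) \<le> \<epsilon> ^ Suc n" by simp
    with Suc show ?case by simp
  qed simp
  moreover have "\<epsilon> ^ Suc n \<ge> 0" using assms by simp
  ultimately show ?thesis by linarith
qed

lemma inverse_binomial_le:
  assumes "1 \<le> k" "k \<le> t"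
  shows "1 / real (t choose k) \<le> (real k / real t) ^ k"
proof -
  have "(real t / real k) ^ k \<le> real (t choose k)"
    using assms by (intro binomial_ge_n_over_k_pow_k) auto
  then have "1 / real (t choose k) \<le> 1 / (real t / real k) ^ k"
    using assms by (intro divide_left_mono) auto
  also have "\<dots> = (real k / real t) ^ k" by (simp add: power_divide)
  finally show ?thesis .
qed

text \<open>
  Cuts with \<open>k < N\<close> hits are controlled by the smallness of both urn probabilities; for \<open>k \<ge> N\<close> the
  factor \<open>1 / (t choose N)\<close> alone beats the \<open>2 ^ N\<close> possible cuts.
\<close>

lemma prob_split_event_bound:
  fixes A B :: "'v set" and \<alpha> \<beta> d :: real and e t :: nat
  defines "\<epsilon> \<equiv> (2 * d * 2 ^ (e + 1))\<^sup>2 * real (card A + card B) / real t"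
  assumes "\<alpha> > 0" "\<beta> > 0" "finite A" "finite B" "A \<noteq> {}" "B \<noteq> {}"
    and one: "1 \<le> \<alpha> * real (card A)" "1 \<le> \<beta> * real (card B)"
    and e: "\<alpha> \<le> real e" "\<beta> \<le> real e" and d: "1 \<le> d"
    and dA: "real (card A) * (2 * \<alpha> * real (card A) / real t) powr \<alpha> \<le> d"
    and dB: "real (card B) * (2 * \<beta> * real (card B) / real t) powr \<beta> \<le> d"
    and small: "2 * \<epsilon> \<le> 1" and t: "t > 0"
  shows "measure_pmf.prob (pair_pmf (polya_urn \<alpha> A t) (polya_urn \<beta> B t)) (split_event A B t) \<le> 2 * \<epsilon>"
proof -
  define N where "N = card A + card B"
  define F where "F = 2 * d * 2 ^ (e + 1)"
  define qA where "qA = (\<lambda>(S :: 'v set) k. pattern_prob \<alpha> (card A) (card S) t k)"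
  define qB where "qB = (\<lambda>(T :: 'v set) k. pattern_prob \<beta> (card B) (card T) t k)"
  define f where "f = (\<lambda>k. \<Sum>S | S \<subseteq> A \<and> card S \<le> k. \<Sum>T | T \<subseteq> B \<and> card T \<le> k. real (t choose k) * (qA S k * qB T k))"
  have eps: "\<epsilon> = F\<^sup>2 * real N / real t" by (simp add: \<epsilon>_def F_def N_def)
  have N1: "N \<ge> 1" using assms by (auto simp: N_def card_gt_0_iff Suc_le_eq)
  have "1 * 1 \<le> d * 2 ^ (e + 1)" using d by (intro mult_mono one_le_power) auto
  then have F2: "F \<ge> 2" by (simp add: F_def)
  then have FF: "F\<^sup>2 \<ge> 2 * 1" unfolding power2_eq_square by (intro mult_mono) auto
  have eps0: "\<epsilon> \<ge> 0" by (simp add: eps)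
  have N_le: "2 * real N \<le> F\<^sup>2 * real N"
    using FF by (intro mult_right_mono) auto
  have Nt: "2 * real N / real t \<le> \<epsilon>"
    using N_le t by (simp add: eps divide_right_mono)
  have qA0: "qA S k \<ge> 0" if "S \<subseteq> A" for S k
    using that assms by (auto simp: qA_def intro!: pattern_prob_nonneg card_mono)
  have qB0: "qB T k \<ge> 0" if "T \<subseteq> B" for T k
    using that assms by (auto simp: qB_def intro!: pattern_prob_nonneg card_mono)
  have "measure_pmf.prob (pair_pmf (polya_urn \<alpha> A t) (polya_urn \<beta> B t)) (split_event A B t) \<le> (\<Sum>k\<in>{1..t div 2}. f k)"
    unfolding f_def qA_def qB_def using assms by (intro prob_split_event_le)
  also have "{1..t div 2} = {1..<N} \<inter> {..t div 2} \<union> {N..t div 2}" using N1 by auto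
  also have "sum f \<dots> = sum f ({1..<N} \<inter> {..t div 2}) + sum f {N..t div 2}"
    by (intro sum.union_disjoint) auto
  also have "sum f ({1..<N} \<inter> {..t div 2}) \<le> (\<Sum>k\<in>{1..<N} \<inter> {..t div 2}. \<epsilon> ^ k)"
  proof (intro sum_mono)
    fix k assume "k \<in> {1..<N} \<inter> {..t div 2}"
    then have k: "1 \<le> k" "2 * k \<le> t" "k < N" by auto
    have C: "real (t choose k) > 0" using k by simp
    have sA: "(\<Sum>S | S \<subseteq> A \<and> card S \<le> k. real (t choose k) * qA S k) \<le> F ^ k"
      unfolding qA_def F_def using assms k by (intro sum_pattern_prob_le) auto
    have sB: "(\<Sum>T | T \<subseteq> B \<and> card T \<le> k. real (t choose k) * qB T k) \<le> F ^ k"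
      unfolding qB_def F_def using assms k by (intro sum_pattern_prob_le) auto
    \<comment> \<open>Both urn sums are completed by their own binomial coefficient, so one of the
      two must be divided out again. The quotient is at most
      \<open>(F\<^sup>2 * k / t) ^ k\<close>.\<close>
    have "f k = (\<Sum>S | S \<subseteq> A \<and> card S \<le> k. real (t choose k) * qA S k) *
        (\<Sum>T | T \<subseteq> B \<and> card T \<le> k. real (t choose k) * qB T k) / real (t choose k)"
      unfolding f_def sum_product sum_divide_distrib using C by (intro sum.cong refl) simp
    also have "\<dots> \<le> F ^ k * F ^ k / real (t choose k)"
      using sA sB C F2 qB0
      by (intro divide_right_mono mult_mono sum_nonneg mult_nonneg_nonneg) auto
    also have "\<dots> = (F ^ k * F ^ k) * (1 / real (t choose k))" by simp
    also have "\<dots> \<le> (F ^ k * F ^ k) * (real k / real t) ^ k"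
      using k F2 by (intro mult_left_mono inverse_binomial_le) auto
    also have "\<dots> = (F\<^sup>2 * real k / real t) ^ k"
      by (simp add: power_mult_distrib power_divide power2_eq_square)
    \<comment> \<open>Replacing \<open>k\<close> by \<open>N\<close> in the base gives a geometric
      series; this is possible only below the threshold \<open>N\<close>.\<close>
    also have "\<dots> \<le> \<epsilon> ^ k"
      unfolding eps using k t by (intro power_mono divide_right_mono mult_left_mono) auto
    finally show "f k \<le> \<epsilon> ^ k" .
  qed
  also have "\<dots> \<le> (\<Sum>k\<in>{1..<N}. \<epsilon> ^ k)"
    using eps0 by (intro sum_mono2) auto
  also have "sum f {N..t div 2} \<le> \<epsilon> ^ N"
  proof -
    have NT: "2 * N \<le> t"
    proof -
      have "2 * real N \<le> \<epsilon> * real t" using Nt t by (simp add: field_simps)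
      also have "\<dots> \<le> 1 * real t" using small eps0 by (intro mult_right_mono) auto
      finally show ?thesis by linarith
    qed
    have CN: "real (t choose N) > 0" using NT by simp
    \<comment> \<open>The size restrictions are dropped. For each of the \<open>2 ^ N\<close> pairs,
      the right word costs at most \<open>1 / (t choose k)\<close>, hence at most
      \<open>1 / (t choose N)\<close> because binomial coefficients increase up to the middle, while
      the left hit-count masses sum to at most 1.\<close>
    have "sum f {N..t div 2} \<le> (\<Sum>k\<in>{N..t div 2}. \<Sum>S\<in>Pow A. \<Sum>T\<in>Pow B. real (t choose k) * (qA S k * qB T k))"
    proof (rule sum_mono)
      fix k
      have "f k \<le> (\<Sum>S | S \<subseteq> A \<and> card S \<le> k. \<Sum>T\<in>Pow B. real (t choose k) * (qA S k * qB T k))"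
        unfolding f_def using assms(5) qA0 qB0 by (intro sum_mono sum_mono2) auto
      also have "\<dots> \<le> (\<Sum>S\<in>Pow A. \<Sum>T\<in>Pow B. real (t choose k) * (qA S k * qB T k))"
        using assms(4) qA0 qB0 by (intro sum_mono2 sum_nonneg mult_nonneg_nonneg) auto
      finally show "f k \<le> (\<Sum>S\<in>Pow A. \<Sum>T\<in>Pow B. real (t choose k) * (qA S k * qB T k))" .
    qed
    also have "\<dots> = (\<Sum>S\<in>Pow A. \<Sum>k\<in>{N..t div 2}. \<Sum>T\<in>Pow B. real (t choose k) * (qA S k * qB T k))"
      by (rule sum.swap)
    also have "\<dots> = (\<Sum>S\<in>Pow A. \<Sum>T\<in>Pow B. \<Sum>k\<in>{N..t div 2}. real (t choose k) * (qA S k * qB T k))"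
      by (intro sum.cong refl sum.swap)
    also have "\<dots> \<le> (\<Sum>S\<in>Pow A. \<Sum>T\<in>Pow B. (real N / real t) ^ N)"
    proof (intro sum_mono)
      fix S T assume ST: "S \<in> Pow A" "T \<in> Pow B"
      have "(\<Sum>k\<in>{N..t div 2}. real (t choose k) * (qA S k * qB T k))
          \<le> (\<Sum>k\<in>{N..t div 2}. real (t choose k) * qA S k * (1 / real (t choose N)))"
      proof (intro sum_mono)
        fix k assume k: "k \<in> {N..t div 2}"
        then have k2: "2 * k \<le> t" by auto
        have C: "real (t choose k) > 0" using k2 by simp
        have "(\<Sum>k\<in>{k}. real (t choose k) * pattern_prob \<beta> (card B) (card T) t k) \<le> 1"
          using ST assms by (intro sum_pattern_prob_le_1) auto
        then have "qB T k \<le> 1 / real (t choose k)"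
          using C by (simp add: qB_def field_simps)
        also have "t choose N \<le> t choose k" using k k2 by (intro binomial_mono) auto
        then have "1 / real (t choose k) \<le> 1 / real (t choose N)"
          using C CN by (intro divide_left_mono) auto
        finally have "qB T k \<le> 1 / real (t choose N)" .
        then have "real (t choose k) * qA S k * qB T k \<le> real (t choose k) * qA S k * (1 / real (t choose N))"
          using ST qA0 by (intro mult_left_mono) auto
        then show "real (t choose k) * (qA S k * qB T k) \<le> real (t choose k) * qA S k * (1 / real (t choose N))"
          by (simp add: mult.assoc)
      qed
      also have "\<dots> = (\<Sum>k\<in>{N..t div 2}. real (t choose k) * qA S k) * (1 / real (t choose N))"
        by (rule sum_distrib_right[symmetric])
      also have "\<dots> \<le> 1 * (1 / real (t choose N))"
        unfolding qA_def using ST assms by (intro mult_right_mono sum_pattern_prob_le_1) auto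
      also have "\<dots> \<le> (real N / real t) ^ N"
        using inverse_binomial_le[of N t] N1 NT by simp
      finally show "(\<Sum>k\<in>{N..t div 2}. real (t choose k) * (qA S k * qB T k)) \<le> (real N / real t) ^ N" .
    qed
    also have "\<dots> = 2 ^ N * (real N / real t) ^ N"
      using assms(4,5) by (simp add: card_Pow N_def power_add)
    also have "\<dots> = (2 * real N / real t) ^ N"
      by (simp add: power_mult_distrib power_divide)
    also have "\<dots> \<le> \<epsilon> ^ N" using Nt by (intro power_mono) auto
    finally show ?thesis .
  qed
  \<comment> \<open>The bound for all large cuts together supplies the next term of the geometric
    series.\<close>
  also have "(\<Sum>k\<in>{1..<N}. \<epsilon> ^ k) + \<epsilon> ^ N = (\<Sum>k\<in>{1..N}. \<epsilon> ^ k)"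
    using N1 by (cases N) (simp_all add: atLeastLessThanSuc_atLeastAtMost)
  also have "\<dots> \<le> 2 * \<epsilon>"
    using eps0 small by (rule sum_power_le_twice)
  finally show ?thesis by simp
qed

section \<open>The critical window\<close>

text \<open>On the time scale given by \<open>m\<close>, the expectation is a convergent factor
  times \<open>N n powr (1 - a / m)\<close>. The exponent vanishes for \<open>a = m\<close> and is
  negative for larger \<open>a\<close>, so only a part with the smallest parameter keeps isolated
  vertices in the limit.\<close>

lemma expected_isolated_tendsto:
  fixes L N T :: "nat \<Rightarrow> nat" and a m x l :: real
  assumes m: "0 < m" "m \<le> a" and x: "x > 0" and l: "l > 0"
    and N: "filterlim N at_top sequentially"
    and LN: "(\<lambda>n. real (L n) / real (N n)) \<longlonglongrightarrow> l"
    and T: "(\<lambda>n. real (T n) / real (N n) powr (1 + 1 / m)) \<longlonglongrightarrow> x"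
  shows "(\<lambda>n. real (L n) * (a * real (L n) / real (T n)) powr a)
    \<longlonglongrightarrow> (if a = m then (a / x) powr a * l powr (1 + a) else 0)"
proof -
  define r s where "r = (\<lambda>n. real (L n) / real (N n))" and "s = (\<lambda>n. real (T n) / real (N n) powr (1 + 1 / m))"
  have Ninf: "filterlim (\<lambda>n. real (N n)) at_top sequentially"
    using filterlim_compose[OF filterlim_real_sequentially N] .
  have "eventually (\<lambda>n. r n > 0) sequentially" "eventually (\<lambda>n. s n > 0) sequentially"
    using LN T l x by (auto simp: r_def s_def dest: order_tendstoD)
  moreover have "eventually (\<lambda>n. real (N n) > 0) sequentially"
    using Ninf unfolding filterlim_at_top_dense by blast
  ultimately have ev: "eventually (\<lambda>n. (a / s n) powr a * r n powr (1 + a) * real (N n) powr (1 - a / m)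
      = real (L n) * (a * real (L n) / real (T n)) powr a) sequentially"
  proof eventually_elim
    case (elim n)
    define M where "M = real (N n)"
    have M: "M > 0" using elim by (simp add: M_def)
    have Lr: "real (L n) = r n * M" using M by (simp add: r_def M_def)
    have Ts: "real (T n) = s n * M powr (1 + 1 / m)" using M by (simp add: s_def M_def)
    have "a * real (L n) / real (T n) = (a / s n) * r n * M powr (- (1 / m))"
    proof -
      have "M powr (1 + 1 / m) = M * M powr (1 / m)" using M by (simp add: powr_add)
      moreover have "M powr (- (1 / m)) = 1 / M powr (1 / m)" by (simp add: powr_minus_divide)
      ultimately show ?thesis
        unfolding Lr Ts using M elim by (simp add: field_simps)
    qed
    then have "(a * real (L n) / real (T n)) powr a = (a / s n) powr a * r n powr a * (M powr (- (1 / m))) powr a"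
      by (simp only: powr_mult)
    also have "(M powr (- (1 / m))) powr a = M powr (- (a / m))" by (simp add: powr_powr)
    finally have eq: "(a * real (L n) / real (T n)) powr a = (a / s n) powr a * r n powr a * M powr (- (a / m))" .
    have "r n powr (1 + a) = r n * r n powr a" "M powr (1 - a / m) = M * M powr (- (a / m))"
      using elim M by (simp_all add: powr_add[symmetric] powr_mult_base)
    then show ?case unfolding eq unfolding Lr M_def[symmetric] by simp
  qed
  have "(\<lambda>n. (a / s n) powr a * r n powr (1 + a)) \<longlonglongrightarrow> (a / x) powr a * l powr (1 + a)"
    using LN T x l m unfolding r_def s_def by (intro tendsto_intros) auto
  moreover have "(\<lambda>n. real (N n) powr (1 - a / m)) \<longlonglongrightarrow> (if a = m then 1 else 0)"
  proof (cases "a = m")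
    case True
    have "eventually (\<lambda>n. 1 = real (N n) powr (1 - a / m)) sequentially"
      using \<open>eventually (\<lambda>n. real (N n) > 0) sequentially\<close> by eventually_elim (use True m in simp)
    then show ?thesis using True by (auto intro: Lim_transform_eventually[OF tendsto_const])
  next
    case False
    then have "1 - a / m < 0" using m by (simp add: field_simps)
    then show ?thesis using False Ninf by (simp add: tendsto_neg_powr)
  qed
  ultimately have "(\<lambda>n. (a / s n) powr a * r n powr (1 + a) * real (N n) powr (1 - a / m))
      \<longlonglongrightarrow> (a / x) powr a * l powr (1 + a) * (if a = m then 1 else 0)"
    by (rule tendsto_mult)
  from Lim_transform_eventually[OF this ev] show ?thesis by (auto split: if_splits)
qed

lemma prob_polya_urn_covers_tendsto:
  fixes A :: "nat \<Rightarrow> 'v set" and N T :: "nat \<Rightarrow> nat" and a m x l :: real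
  assumes m: "0 < m" "m \<le> a" and x: "x > 0" and l: "l > 0"
    and A: "\<And>n. finite (A n)" "filterlim (\<lambda>n. card (A n)) at_top sequentially"
    and N: "filterlim N at_top sequentially"
    and LN: "(\<lambda>n. real (card (A n)) / real (N n)) \<longlonglongrightarrow> l"
    and T: "(\<lambda>n. real (T n) / real (N n) powr (1 + 1 / m)) \<longlonglongrightarrow> x"
  shows "(\<lambda>n. measure_pmf.prob (polya_urn a (A n) (T n)) {us. A n \<subseteq> set us})
    \<longlonglongrightarrow> exp (- (if a = m then (a / x) powr a * l powr (1 + a) else 0))"
proof -
  have Ninf: "filterlim (\<lambda>n. real (N n)) at_top sequentially"
    using filterlim_compose[OF filterlim_real_sequentially N] .
  have Npos: "eventually (\<lambda>n. real (N n) > 0) sequentially"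
    using Ninf unfolding filterlim_at_top_dense by blast
  have powr: "filterlim (\<lambda>n. real (N n) powr (1 / m)) at_top sequentially"
    using m by (intro filterlim_compose[OF real_powr_at_top Ninf]) auto
  \<comment> \<open>The number of draws per vertex is this convergent ratio times
    \<open>N n powr (1 / m)\<close>, hence unbounded, as the Poisson limit requires.\<close>
  have "(\<lambda>n. real (T n) / real (N n) powr (1 + 1 / m) / (real (card (A n)) / real (N n))) \<longlonglongrightarrow> x / l"
    using T LN l by (intro tendsto_divide) auto
  then have inf: "filterlim (\<lambda>n. (real (T n) / real (N n) powr (1 + 1 / m) / (real (card (A n)) / real (N n)))
      * real (N n) powr (1 / m)) at_top sequentially"
    by (rule filterlim_tendsto_pos_mult_at_top[OF _ divide_pos_pos[OF x l] powr])
  have eq: "eventually (\<lambda>n. (real (T n) / real (N n) powr (1 + 1 / m) / (real (card (A n)) / real (N n)))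
      * real (N n) powr (1 / m) = real (T n) / real (card (A n))) sequentially"
    using Npos by eventually_elim (simp add: powr_add)
  have TL: "filterlim (\<lambda>n. real (T n) / real (card (A n))) at_top sequentially"
    by (rule filterlim_cong[OF refl refl eq, THEN iffD1, OF inf])
  have "eventually (\<lambda>n. card (A n) \<ge> 1) sequentially"
    using A by (auto simp: filterlim_at_top)
  then have ev: "eventually (\<lambda>n. (\<Sum>k\<le>card (A n). (-1) ^ k * (real (card (A n) choose k) *
      (\<Prod>j<T n. (a * real (card (A n)) - a * real k + real j) / (a * real (card (A n)) + real j))))
      = measure_pmf.prob (polya_urn a (A n) (T n)) {us. A n \<subseteq> set us}) sequentially"
  proof eventually_elim
    case (elim n)
    then have "A n \<noteq> {}" by auto
    then show ?case using m A by (subst prob_polya_urn_covers) auto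
  qed
  show ?thesis
    using m by (intro Lim_transform_eventually[OF alternating_avoidance_tendsto ev]
        expected_isolated_tendsto[OF m x l N LN T] A TL) auto
qed

text \<open>The covering probability \<open>c\<close> and the probability \<open>p\<close> differ by
  at most a multiple of \<open>N n / T n\<close>, which vanishes because \<open>T n\<close> grows
  like a power of \<open>N n\<close> above the first. Isolated vertices are thus the only
  obstruction in the limit, and the contributions of the independent parts add in the
  exponent.\<close>

lemma prob_connected_critical:
  fixes A B :: "nat \<Rightarrow> 'v set" and T :: "nat \<Rightarrow> nat" and \<alpha> \<beta> x l r :: real
  defines "m \<equiv> min \<alpha> \<beta>" and "N \<equiv> \<lambda>n. card (A n) + card (B n)"
  assumes pos: "\<alpha> > 0" "\<beta> > 0" "x > 0" "l > 0" "r > 0"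
    and fin: "\<And>n. finite (A n)" "\<And>n. finite (B n)" and disj: "\<And>n. A n \<inter> B n = {}"
    and Ainf: "filterlim (\<lambda>n. card (A n)) at_top sequentially"
    and Binf: "filterlim (\<lambda>n. card (B n)) at_top sequentially"
    and lA: "(\<lambda>n. real (card (A n)) / real (N n)) \<longlonglongrightarrow> l"
    and lB: "(\<lambda>n. real (card (B n)) / real (N n)) \<longlonglongrightarrow> r"
    and T: "(\<lambda>n. real (T n) / real (N n) powr (1 + 1 / m)) \<longlonglongrightarrow> x"
  shows "(\<lambda>n. measure_pmf.prob (multigraph_process \<alpha> \<beta> (A n) (B n) (T n)) {M. is_connected (A n) (B n) M})
    \<longlonglongrightarrow> exp (- ((if \<alpha> = m then (\<alpha> / x) powr \<alpha> * l powr (1 + \<alpha>) else 0) +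
                (if \<beta> = m then (\<beta> / x) powr \<beta> * r powr (1 + \<beta>) else 0)))"
proof -
  define cA where "cA = (if \<alpha> = m then (\<alpha> / x) powr \<alpha> * l powr (1 + \<alpha>) else 0)"
  define cB where "cB = (if \<beta> = m then (\<beta> / x) powr \<beta> * r powr (1 + \<beta>) else 0)"
  define c where "c = (\<lambda>n. measure_pmf.prob (polya_urn \<alpha> (A n) (T n)) {us. A n \<subseteq> set us} *
      measure_pmf.prob (polya_urn \<beta> (B n) (T n)) {vs. B n \<subseteq> set vs})"
  define p where "p = (\<lambda>n. measure_pmf.prob (multigraph_process \<alpha> \<beta> (A n) (B n) (T n)) {M. is_connected (A n) (B n) M})"
  define b where "b = (\<lambda>n. measure_pmf.prob (pair_pmf (polya_urn \<alpha> (A n) (T n)) (polya_urn \<beta> (B n) (T n)))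
      (split_event (A n) (B n) (T n)))"
  have m: "0 < m" "m \<le> \<alpha>" "m \<le> \<beta>" using pos by (auto simp: m_def)
  have N: "filterlim N at_top sequentially"
    by (rule filterlim_at_top_mono[OF Ainf]) (simp add: N_def)
  have Ninf: "filterlim (\<lambda>n. real (N n)) at_top sequentially"
    using filterlim_compose[OF filterlim_real_sequentially N] .
  have Ainf': "filterlim (\<lambda>n. real (card (A n))) at_top sequentially"
    using filterlim_compose[OF filterlim_real_sequentially Ainf] .
  have Binf': "filterlim (\<lambda>n. real (card (B n))) at_top sequentially"
    using filterlim_compose[OF filterlim_real_sequentially Binf] .
  have c: "c \<longlonglongrightarrow> exp (- (cA + cB))"
    unfolding c_def cA_def cB_def minus_add_distrib exp_add
    by (intro tendsto_mult prob_polya_urn_covers_tendsto[OF _ _ _ _ _ _ N] m pos fin Ainf Binf lA lB T)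
  \<comment> \<open>The union bound evaluates the expectation with doubled base, whence
    \<open>2 powr \<alpha>\<close> and \<open>2 powr \<beta>\<close>; the added 1 leaves room above
    the limits \<open>cA\<close> and \<open>cB\<close>.\<close>
  define d where "d = max 1 (max (2 powr \<alpha> * (cA + 1)) (2 powr \<beta> * (cB + 1)))"
  have d1: "1 \<le> d" by (simp add: d_def)
  obtain e :: nat where "max \<alpha> \<beta> \<le> real e" using real_arch_simple by blast
  then have e: "\<alpha> \<le> real e" "\<beta> \<le> real e" by simp_all
  define \<epsilon> where "\<epsilon> = (\<lambda>n. (2 * d * 2 ^ (e + 1))\<^sup>2 * real (N n) / real (T n))"
  have NT: "(\<lambda>n. real (N n) / real (T n)) \<longlonglongrightarrow> 0"
  proof -
    have "(\<lambda>n. real (N n) powr (- (1 / m)) / (real (T n) / real (N n) powr (1 + 1 / m))) \<longlonglongrightarrow> 0 / x"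
      using m pos by (intro tendsto_divide T tendsto_neg_powr Ninf) auto
    moreover have "eventually (\<lambda>n. real (N n) > 0) sequentially"
      using Ninf unfolding filterlim_at_top_dense by blast
    then have "eventually (\<lambda>n. real (N n) powr (- (1 / m)) / (real (T n) / real (N n) powr (1 + 1 / m))
        = real (N n) / real (T n)) sequentially"
      by eventually_elim (simp add: powr_add powr_minus field_simps)
    ultimately show ?thesis by (auto intro: Lim_transform_eventually)
  qed
  then have eps: "\<epsilon> \<longlonglongrightarrow> 0"
    unfolding \<epsilon>_def using tendsto_mult_left[OF NT, of "(2 * d * 2 ^ (e + 1))\<^sup>2"] by simp
  have ev_d: "eventually (\<lambda>n. real (K n) * (2 * a * real (K n) / real (T n)) powr a \<le> d) sequentially"
    if "(\<lambda>n. real (K n) * (a * real (K n) / real (T n)) powr a) \<longlonglongrightarrow> y" "2 powr a * (y + 1) \<le> d" "a > 0" for K :: "nat \<Rightarrow> nat" and a y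
  proof -
    have "eventually (\<lambda>n. real (K n) * (a * real (K n) / real (T n)) powr a < y + 1) sequentially"
      using that(1) by (rule order_tendstoD) simp
    then show ?thesis
    proof eventually_elim
      case (elim n)
      have "real (K n) * (2 * a * real (K n) / real (T n)) powr a = 2 powr a * (real (K n) * (a * real (K n) / real (T n)) powr a)"
        using powr_mult[of 2 "a * real (K n) / real (T n)" a] by (simp add: mult_ac)
      also have "\<dots> \<le> 2 powr a * (y + 1)" using elim by (intro mult_left_mono) auto
      finally show ?case using that(2) by linarith
    qed
  qed
  have "eventually (\<lambda>n. b n \<le> 2 * \<epsilon> n \<and> p n \<le> c n \<and> c n \<le> p n + b n) sequentially"
  proof -
    have "eventually (\<lambda>n. real (card (A n)) * (2 * \<alpha> * real (card (A n)) / real (T n)) powr \<alpha> \<le> d) sequentially"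
      using expected_isolated_tendsto[OF m(1,2) pos(3,4) N lA T] pos
      by (intro ev_d) (auto simp: cA_def d_def)
    moreover have "eventually (\<lambda>n. real (card (B n)) * (2 * \<beta> * real (card (B n)) / real (T n)) powr \<beta> \<le> d) sequentially"
      using expected_isolated_tendsto[OF m(1,3) pos(3,5) N lB T] pos
      by (intro ev_d) (auto simp: cB_def d_def)
    moreover have "eventually (\<lambda>n. \<epsilon> n < 1 / 2) sequentially"
      using eps by (rule order_tendstoD) simp
    moreover have "eventually (\<lambda>n. real (T n) / real (N n) powr (1 + 1 / m) > 0) sequentially"
      using T pos by (auto dest: order_tendstoD)
    moreover have "eventually (\<lambda>n. real (card (A n)) \<ge> max 1 (1 / \<alpha>)) sequentially"
      using Ainf' unfolding filterlim_at_top by blast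
    moreover have "eventually (\<lambda>n. real (card (B n)) \<ge> max 1 (1 / \<beta>)) sequentially"
      using Binf' unfolding filterlim_at_top by blast
    ultimately show ?thesis
    proof eventually_elim
      case (elim n)
      have ne: "A n \<noteq> {}" "B n \<noteq> {}" using elim by auto
      have t: "T n > 0" using elim(4) by (cases "T n = 0") auto
      have one: "1 \<le> \<alpha> * real (card (A n))" "1 \<le> \<beta> * real (card (B n))"
        using elim(5,6) pos by (simp_all add: divide_le_eq mult.commute)
      have small: "2 * ((2 * d * 2 ^ (e + 1))\<^sup>2 * real (card (A n) + card (B n)) / real (T n)) \<le> 1"
        using elim(3) by (simp add: \<epsilon>_def N_def)
      have "b n \<le> 2 * \<epsilon> n"
        unfolding b_def \<epsilon>_def N_def
        by (intro prob_split_event_bound pos fin ne one e d1 elim(1) elim(2) small t)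
      moreover have "p n \<le> c n" "c n \<le> p n + b n"
        unfolding p_def c_def b_def by (intro prob_connected_bounds pos fin ne disj)+
      ultimately show ?case by simp
    qed
  qed
  then have "eventually (\<lambda>n. c n - 2 * \<epsilon> n \<le> p n) sequentially" "eventually (\<lambda>n. p n \<le> c n) sequentially"
    by (eventually_elim, linarith)+
  moreover have "(\<lambda>n. c n - 2 * \<epsilon> n) \<longlonglongrightarrow> exp (- (cA + cB))"
    using tendsto_diff[OF c tendsto_mult_left[OF eps, of 2]] by simp
  ultimately have "p \<longlonglongrightarrow> exp (- (cA + cB))"
    by (rule tendsto_sandwich[OF _ _ _ c])
  then show ?thesis by (simp add: p_def cA_def cB_def)
qed

theorem theorem1p2:
  fixes \<alpha> \<beta> \<gamma> :: real
    and A B :: "nat \<Rightarrow> 'v set"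
    and L R :: "nat \<Rightarrow> nat"
    and t :: "nat \<Rightarrow> nat"
    and \<tau> p :: "nat \<Rightarrow> real"
  assumes "\<alpha> > 0" and "\<beta> > 0"
    and "\<And>n. finite (A n)" and "\<And>n. finite (B n)" and "\<And>n. A n \<inter> B n = {}"
    and "\<And>n. card (A n) = L n" and "\<And>n. card (B n) = R n"
    and "filterlim L at_top sequentially" and "filterlim R at_top sequentially"
    and "\<gamma> > 0" and "(\<lambda>n. real (R n) / real (L n)) \<longlonglongrightarrow> \<gamma>"
  defines "\<tau> \<equiv> (\<lambda>n. real (L n + R n) powr (1 + 1 / min \<alpha> \<beta>))"
    and "p \<equiv> (\<lambda>n. measure_pmf.prob (multigraph_process \<alpha> \<beta> (A n) (B n) (t n))
                   {M. is_connected (A n) (B n) M})"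
  shows "((\<lambda>n. real (t n) / \<tau> n) \<longlonglongrightarrow> 0 \<longrightarrow> p \<longlonglongrightarrow> 0) \<and>
    (filterlim (\<lambda>n. real (t n) / \<tau> n) at_top sequentially \<longrightarrow> p \<longlonglongrightarrow> 1) \<and>
    (\<forall>x>0. (\<lambda>n. real (t n) / \<tau> n) \<longlonglongrightarrow> x \<longrightarrow>
      (\<alpha> \<noteq> \<beta> \<longrightarrow>
        p \<longlonglongrightarrow> exp (- ((min \<alpha> \<beta> / x) powr min \<alpha> \<beta> *
              zeta \<gamma> (inv (rho \<alpha> \<beta>) (min \<alpha> \<beta>)) powr (- 1 - min \<alpha> \<beta>)))) \<and>
      (\<alpha> = \<beta> \<longrightarrow>
        p \<longlonglongrightarrow> exp (- ((\<alpha> / x) powr \<alpha> *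
              ((1 + \<gamma>) powr (- 1 - \<alpha>) + (1 + 1 / \<gamma>) powr (- 1 - \<alpha>))))))"
proof -
  define m where "m = min \<alpha> \<beta>"
  define N where "N = (\<lambda>n. card (A n) + card (B n))"
  define P where "P = (\<lambda>n s. measure_pmf.prob (multigraph_process \<alpha> \<beta> (A n) (B n) s) {M. is_connected (A n) (B n) M})"
  \<comment> \<open>With this constant, the critical limit for equal and for distinct parameters has
    the single form \<open>exp (- (K * x powr (- m)))\<close>, whose behaviour in \<open>x\<close>
    yields the extreme regimes.\<close>
  define K where "K = m powr m * ((if \<alpha> = m then (1 + \<gamma>) powr (- 1 - m) else 0) +
      (if \<beta> = m then (1 + 1 / \<gamma>) powr (- 1 - m) else 0))"
  have m: "m > 0" "\<alpha> = m \<or> \<beta> = m" using assms by (auto simp: m_def)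
  have g: "1 + \<gamma> > 0" "1 + 1 / \<gamma> > 0" using assms by (auto intro: add_pos_pos)
  have K0: "K > 0" unfolding K_def using m g by (auto intro!: mult_pos_pos add_pos_nonneg add_nonneg_pos)
  have \<tau>: "\<tau> = (\<lambda>n. real (N n) powr (1 + 1 / m))" by (simp add: \<tau>_def N_def m_def assms(6,7))
  have p: "p = (\<lambda>n. P n (t n))" by (simp add: p_def P_def)
  have P01: "0 \<le> P n s" "P n s \<le> 1" for n s by (simp_all add: P_def)
  have P_mono: "P n s \<le> P n s'" if "s \<le> s'" for n s s'
    unfolding P_def using that by (rule prob_connected_mono)
  have Linf: "filterlim (\<lambda>n. real (L n)) at_top sequentially"
    using filterlim_compose[OF filterlim_real_sequentially assms(8)] .
  have Rinf: "filterlim (\<lambda>n. real (R n)) at_top sequentially"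
    using filterlim_compose[OF filterlim_real_sequentially assms(9)] .
  have "filterlim N at_top sequentially"
    by (rule filterlim_at_top_mono[OF assms(8)]) (simp add: N_def assms(6))
  then have Ninf: "filterlim (\<lambda>n. real (N n)) at_top sequentially"
    by (rule filterlim_compose[OF filterlim_real_sequentially])
  have \<tau>inf: "filterlim \<tau> at_top sequentially"
    unfolding \<tau> using m by (intro filterlim_compose[OF real_powr_at_top Ninf]) (auto intro: add_pos_pos)
  have Lpos: "eventually (\<lambda>n. real (L n) > 0) sequentially" and Rpos: "eventually (\<lambda>n. real (R n) > 0) sequentially"
    using Linf Rinf unfolding filterlim_at_top_dense by blast+
  \<comment> \<open>The two values of \<open>zeta\<close> are the reciprocals of the limiting
    proportions of the parts among all vertices.\<close>
  have "(\<lambda>n. 1 / (1 + real (R n) / real (L n))) \<longlonglongrightarrow> 1 / (1 + \<gamma>)"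
    using assms(11) g by (intro tendsto_intros) auto
  moreover have "eventually (\<lambda>n. 1 / (1 + real (R n) / real (L n)) = real (card (A n)) / real (N n)) sequentially"
    using Lpos by eventually_elim (simp add: N_def assms(6,7) field_simps)
  ultimately have lA: "(\<lambda>n. real (card (A n)) / real (N n)) \<longlonglongrightarrow> 1 / (1 + \<gamma>)"
    by (rule Lim_transform_eventually)
  have "(\<lambda>n. 1 / (1 + 1 / (real (R n) / real (L n)))) \<longlonglongrightarrow> 1 / (1 + 1 / \<gamma>)"
    using assms(10,11) g by (intro tendsto_intros) auto
  moreover have "eventually (\<lambda>n. 1 / (1 + 1 / (real (R n) / real (L n))) = real (card (B n)) / real (N n)) sequentially"
    using Lpos Rpos by eventually_elim (simp add: N_def assms(6,7) field_simps)
  ultimately have lB: "(\<lambda>n. real (card (B n)) / real (N n)) \<longlonglongrightarrow> 1 / (1 + 1 / \<gamma>)"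
    by (rule Lim_transform_eventually)
  have inv_powr: "(1 / y) powr (1 + m) = y powr (- 1 - m)" if "y > 0" for y :: real
    using that by (simp add: powr_divide powr_minus_divide[symmetric])
  have critical: "(\<lambda>n. P n (T n)) \<longlonglongrightarrow> exp (- (K * x powr (- m)))"
    if "x > 0" "(\<lambda>n. real (T n) / \<tau> n) \<longlonglongrightarrow> x" for x and T :: "nat \<Rightarrow> nat"
  proof -
    have "(m / x) powr m = m powr m * x powr (- m)"
      using m that by (simp add: powr_divide powr_minus_divide)
    then have "(if \<alpha> = m then (\<alpha> / x) powr \<alpha> * (1 / (1 + \<gamma>)) powr (1 + \<alpha>) else 0) +
        (if \<beta> = m then (\<beta> / x) powr \<beta> * (1 / (1 + 1 / \<gamma>)) powr (1 + \<beta>) else 0) = K * x powr (- m)"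
      using inv_powr[OF g(1)] inv_powr[OF g(2)] by (auto simp: K_def algebra_simps simp del: minus_diff_eq)
    moreover have "(\<lambda>n. P n (T n)) \<longlonglongrightarrow> exp (- ((if \<alpha> = m then (\<alpha> / x) powr \<alpha> * (1 / (1 + \<gamma>)) powr (1 + \<alpha>) else 0) +
        (if \<beta> = m then (\<beta> / x) powr \<beta> * (1 / (1 + 1 / \<gamma>)) powr (1 + \<beta>) else 0)))"
      unfolding P_def m_def
      using assms(1-5,8,9) g that lA lB
      by (intro prob_connected_critical) (auto simp: assms(6,7) N_def \<tau> m_def)
    ultimately show ?thesis by simp
  qed
  \<comment> \<open>Reference times inside the critical window at level \<open>x\<close>, with which
    a general \<open>t\<close> is compared by monotonicity.\<close>
  define T where "T = (\<lambda>x n. nat \<lceil>x * \<tau> n\<rceil>)"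
  have T: "(\<lambda>n. real (T x n) / \<tau> n) \<longlonglongrightarrow> x" if "x > 0" for x
  proof (rule tendsto_sandwich)
    have pos: "eventually (\<lambda>n. \<tau> n > 0) sequentially"
      using \<tau>inf by (auto simp: filterlim_at_top_dense)
    show "eventually (\<lambda>n. x \<le> real (T x n) / \<tau> n) sequentially"
      using pos by eventually_elim (use that in \<open>auto simp: T_def field_simps\<close>)
    show "eventually (\<lambda>n. real (T x n) / \<tau> n \<le> x + 1 / \<tau> n) sequentially"
      using pos
    proof eventually_elim
      case (elim n)
      then have "real (T x n) = of_int \<lceil>x * \<tau> n\<rceil>" using that by (simp add: T_def)
      then have "real (T x n) \<le> x * \<tau> n + 1" by linarith
      then show ?case using elim by (simp add: field_simps)
    qed
    have "(\<lambda>n. x + 1 / \<tau> n) \<longlonglongrightarrow> x + 0"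
      by (intro tendsto_intros tendsto_divide_0[OF tendsto_const filterlim_at_top_imp_at_infinity[OF \<tau>inf]])
    then show "(\<lambda>n. x + 1 / \<tau> n) \<longlonglongrightarrow> x" by simp
  qed simp
  have low: "p \<longlonglongrightarrow> 0" if t0: "(\<lambda>n. real (t n) / \<tau> n) \<longlonglongrightarrow> 0"
  proof (rule tendstoI)
    fix \<epsilon> :: real assume \<epsilon>: "\<epsilon> > 0"
    \<comment> \<open>A level \<open>x\<close> is fixed whose critical limit is already below
      \<epsilon>; eventually \<open>t n\<close> lies before the reference time of that
      level.\<close>
    have "((\<lambda>x. exp (- (K * x powr (- m)))) \<longlongrightarrow> 0) (at_right 0)"
      using K0 m by real_asymp
    then have "eventually (\<lambda>x. exp (- (K * x powr (- m))) < \<epsilon> \<and> x > 0) (at_right 0)"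
      using \<epsilon> by (intro eventually_conj order_tendstoD eventually_at_right_less)
    then obtain x where x: "x > 0" "exp (- (K * x powr (- m))) < \<epsilon>"
      using eventually_happens trivial_limit_at_right_real by blast
    have "eventually (\<lambda>n. P n (T x n) < \<epsilon>) sequentially"
      using critical[OF x(1) T[OF x(1)]] x(2) by (rule order_tendstoD)
    moreover have "eventually (\<lambda>n. real (t n) / \<tau> n < x) sequentially"
      using t0 x(1) by (rule order_tendstoD)
    moreover have "eventually (\<lambda>n. \<tau> n > 0) sequentially"
      using \<tau>inf by (auto simp: filterlim_at_top_dense)
    ultimately show "eventually (\<lambda>n. dist (p n) 0 < \<epsilon>) sequentially"
    proof eventually_elim
      case (elim n)
      then have "real (t n) \<le> x * \<tau> n" by (simp add: field_simps)
      then have "t n \<le> T x n" unfolding T_def by linarith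
      then have "p n \<le> P n (T x n)" unfolding p by (rule P_mono)
      then show ?case using elim P01(1)[of n "t n"] by (simp add: p)
    qed
  qed
  have high: "p \<longlonglongrightarrow> 1" if tinf: "filterlim (\<lambda>n. real (t n) / \<tau> n) at_top sequentially"
  proof (rule tendstoI)
    fix \<epsilon> :: real assume \<epsilon>: "\<epsilon> > 0"
    \<comment> \<open>Symmetrically, a large level \<open>x\<close> has critical limit above
      \<open>1 - \<epsilon>\<close>, and \<open>t n\<close> eventually passes its reference
      time.\<close>
    have "((\<lambda>x. exp (- (K * x powr (- m)))) \<longlongrightarrow> 1) at_top"
      using K0 m by real_asymp
    then have "eventually (\<lambda>x. exp (- (K * x powr (- m))) > 1 - \<epsilon> \<and> x > 0) at_top"
      using \<epsilon> by (intro eventually_conj order_tendstoD eventually_gt_at_top) auto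
    then obtain x where x: "x > 0" "1 - \<epsilon> < exp (- (K * x powr (- m)))"
      using eventually_happens trivial_limit_at_top_linorder by blast
    have "eventually (\<lambda>n. P n (T x n) > 1 - \<epsilon>) sequentially"
      using critical[OF x(1) T[OF x(1)]] x(2) by (rule order_tendstoD)
    moreover have "eventually (\<lambda>n. real (t n) / \<tau> n > x) sequentially"
      using tinf by (auto simp: filterlim_at_top_dense)
    moreover have "eventually (\<lambda>n. \<tau> n > 0) sequentially"
      using \<tau>inf by (auto simp: filterlim_at_top_dense)
    ultimately show "eventually (\<lambda>n. dist (p n) 1 < \<epsilon>) sequentially"
    proof eventually_elim
      case (elim n)
      then have "x * \<tau> n \<le> real (t n)" by (simp add: field_simps)
      then have "T x n \<le> t n" by (simp add: T_def)
      then have "P n (T x n) \<le> p n" unfolding p by (rule P_mono)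
      then show ?case using elim P01(2)[of n "t n"] by (simp add: p dist_real_def)
    qed
  qed
  have mid: "(\<alpha> \<noteq> \<beta> \<longrightarrow>
        p \<longlonglongrightarrow> exp (- ((min \<alpha> \<beta> / x) powr min \<alpha> \<beta> *
              zeta \<gamma> (inv (rho \<alpha> \<beta>) (min \<alpha> \<beta>)) powr (- 1 - min \<alpha> \<beta>)))) \<and>
      (\<alpha> = \<beta> \<longrightarrow>
        p \<longlonglongrightarrow> exp (- ((\<alpha> / x) powr \<alpha> *
              ((1 + \<gamma>) powr (- 1 - \<alpha>) + (1 + 1 / \<gamma>) powr (- 1 - \<alpha>)))))"
    if x: "x > 0" and tx: "(\<lambda>n. real (t n) / \<tau> n) \<longlonglongrightarrow> x" for x
  proof -
    have lim: "p \<longlonglongrightarrow> exp (- (K * x powr (- m)))"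
      using critical[OF x tx] by (simp add: p)
    have mx: "(m / x) powr m = m powr m * x powr (- m)"
      using m x by (simp add: powr_divide powr_minus_divide)
    show ?thesis
    proof (intro conjI impI)
      assume ne: "\<alpha> \<noteq> \<beta>"
      have "zeta \<gamma> (inv (rho \<alpha> \<beta>) m) = (if \<alpha> = m then 1 + \<gamma> else 1 + 1 / \<gamma>)"
        using m ne inv_f_f[OF inj_rho[OF ne], of LeftPart] inv_f_f[OF inj_rho[OF ne], of RightPart] by auto
      then have "K * x powr (- m) = (m / x) powr m * zeta \<gamma> (inv (rho \<alpha> \<beta>) m) powr (- 1 - m)"
        unfolding K_def mx using m ne by auto
      then show "p \<longlonglongrightarrow> exp (- ((min \<alpha> \<beta> / x) powr min \<alpha> \<beta> *
              zeta \<gamma> (inv (rho \<alpha> \<beta>) (min \<alpha> \<beta>)) powr (- 1 - min \<alpha> \<beta>)))"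
        using lim by (simp add: m_def)
    next
      assume eq: "\<alpha> = \<beta>"
      then have "\<alpha> = m" "\<beta> = m" using m by auto
      then show "p \<longlonglongrightarrow> exp (- ((\<alpha> / x) powr \<alpha> *
              ((1 + \<gamma>) powr (- 1 - \<alpha>) + (1 + 1 / \<gamma>) powr (- 1 - \<alpha>))))"
        using lim mx by (simp add: K_def mult_ac)
    qed
  qed
  show ?thesis using low high mid by blast
qed

end
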